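(* Let $n\geqslant 2$ and $d\geqslant 1$. Take the basis $\{E_{ij}\ (1\leqslant i\neq j\leqslant n),\ E_{ss}-E_{s+1,s+1}\ (1\leqslant s\leqslant n-1)\}$ of $\mathfrak{sl}_n(\mathbb{C})$, assigning variable $x_{ij}$ to $E_{ij}$ ($i\neq j$) and $x_{ss}$ to $E_{ss}-E_{s+1,s+1}$, and let $X=\sum_{s=1}^{n-1}x_{ss}(E_{ss}-E_{s+1,s+1})+\sum_{i\neq j}x_{ij}E_{ij}$ be the generic matrix, so its diagonal is $(x_{11},\,x_{22}-x_{11},\,\dots,\,x_{n-1,n-1}-x_{n-2,n-2},\,-x_{n-1,n-1})$. Let $\mathrm{tr}_i=\mathrm{Tr}(X^i)$. Then the coefficient algebra $B_{\mathfrak{sl}_n(\mathbb{C})}(S^d(\mathbb{C}^n))$ with respect to this basis equals $\mathbb{C}[\mathrm{tr}_2,\mathrm{tr}_3,\dots,\mathrm{tr}_n]$, which is a polynomial algebra and coincides with the invariant ring $\mathbb{C}[\mathfrak{sl}_n(\mathbb{C})]^{\mathrm{SL}_n(\mathbb{C})}$ of the conjugation action of $\mathrm{SL}_n(\mathbb{C})$ on $\mathfrak{sl}_n(\mathbb{C})$ (in the coordinates $x_{ij},x_{ss}$).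
   Context: Let $\mathfrak{g}$ be a finite-dimensional Lie algebra over a field $k$ with a fixed basis $\{g_1,\dots,g_N\}$, and $V$ an $m$-dimensional representation; write $[g]$ for the matrix of $g$ acting on $V$. The characteristic polynomial of $\mathfrak g$ on $V$ is $\varphi_{\mathfrak g}(V)=\det(x_0 I+\sum_l y_l[g_l])$ with $x_0$ and one variable $y_l$ per basis element indeterminates; writing $\varphi_{\mathfrak g}(V)=x_0^m+c_1x_0^{m-1}+\cdots+c_m$, the coefficient algebra $B_{\mathfrak g}(V)$ is the $k$-subalgebra generated by $c_1,\dots,c_m$. $E_{ij}$ denotes the matrix unit. $\mathbb{C}^n$ is the standard representation with basis $e_1,\dots,e_n$, and $S^d(\mathbb{C}^n)$ its $d$-th symmetric power with action $g\cdot(e_{i_1}\cdots e_{i_d})=\sum_{s=1}^d e_{i_1}\cdots g(e_{i_s})\cdots e_{i_d}$. *)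

theory Defs
  imports "Jordan_Normal_Form.Determinant" "HOL-Computational_Algebra.Polynomial"
          "HOL-Library.Poly_Mapping"
begin

definition Eunit :: "nat \<Rightarrow> nat \<Rightarrow> nat \<Rightarrow> complex mat" where
  "Eunit n i j = mat n n (\<lambda>(a,b). if a = i \<and> b = j then 1 else 0)"

(* index set of the chosen basis of sl_n: (i,j) with i \<noteq> j stands for E_ij,
   (s,s) with s+1 < n stands for E_ss - E_{s+1,s+1} *)
definition sl_index :: "nat \<Rightarrow> (nat \<times> nat) set" where
  "sl_index n = {(i,j). i < n \<and> j < n \<and> (i \<noteq> j \<or> i + 1 < n)}"

definition sl_basis :: "nat \<Rightarrow> nat \<times> nat \<Rightarrow> complex mat" where
  "sl_basis n l = (case l of (i,j) \<Rightarrow>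
     if i \<noteq> j then Eunit n i j
     else mat n n (\<lambda>(a,b). Eunit n i i $$ (a,b) - Eunit n (i+1) (i+1) $$ (a,b)))"

definition genmat :: "nat \<Rightarrow> (nat \<times> nat \<Rightarrow> complex) \<Rightarrow> complex mat" where
  "genmat n y = mat n n (\<lambda>(a,b). \<Sum>l\<in>sl_index n. y l * sl_basis n l $$ (a,b))"

(* monomial basis of S^d(C^n): exponent vectors of length n and total degree d *)
fun sym_monos :: "nat \<Rightarrow> nat \<Rightarrow> nat list list" where
  "sym_monos 0 d = (if d = 0 then [[]] else [])"
| "sym_monos (Suc n) d = concat (map (\<lambda>k. map (\<lambda>a. k # a) (sym_monos n (d - k))) [0..<Suc d])"

(* matrix of g acting on S^d(C^n) as a derivation:
   g.(e_{i1}...e_{id}) = \<Sum>_s e_{i1}..g(e_{is})..e_{id};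
   on e^a this is \<Sum>_{i,k} a_k g_{ik} e^{a - e_k + e_i} *)
definition symrep :: "nat \<Rightarrow> nat \<Rightarrow> complex mat \<Rightarrow> complex mat" where
  "symrep n d g = (let B = sym_monos n d in
     mat (length B) (length B) (\<lambda>(r,c).
       let a = B ! c; b = B ! r in
       \<Sum>i<n. \<Sum>k<n. if 1 \<le> a ! k \<and> b = (a[k := a ! k - 1])[i := (a[k := a ! k - 1]) ! i + 1]
                     then of_nat (a ! k) * g $$ (i,k) else 0))"

definition genrep :: "nat \<Rightarrow> nat \<Rightarrow> (nat \<times> nat \<Rightarrow> complex) \<Rightarrow> complex mat" where
  "genrep n d y = (let m = length (sym_monos n d) in
     mat m m (\<lambda>(r,c). \<Sum>l\<in>sl_index n. y l * symrep n d (sl_basis n l) $$ (r,c)))"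

definition charpoly_gen :: "nat \<Rightarrow> nat \<Rightarrow> (nat \<times> nat \<Rightarrow> complex) \<Rightarrow> complex poly" where
  "charpoly_gen n d y = (let m = length (sym_monos n d) in
     det (mat m m (\<lambda>(a,b). (if a = b then [:0, 1:] else 0) + [: genrep n d y $$ (a,b) :])))"

inductive_set alg_gen :: "('b \<Rightarrow> complex) set \<Rightarrow> ('b \<Rightarrow> complex) set" for S where
  const: "(\<lambda>_. c) \<in> alg_gen S"
| gen: "f \<in> S \<Longrightarrow> f \<in> alg_gen S"
| add: "f \<in> alg_gen S \<Longrightarrow> g \<in> alg_gen S \<Longrightarrow> (\<lambda>y. f y + g y) \<in> alg_gen S"
| mult: "f \<in> alg_gen S \<Longrightarrow> g \<in> alg_gen S \<Longrightarrow> (\<lambda>y. f y * g y) \<in> alg_gen S"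

definition coeff_alg :: "nat \<Rightarrow> nat \<Rightarrow> ((nat \<times> nat \<Rightarrow> complex) \<Rightarrow> complex) set" where
  "coeff_alg n d = (let m = length (sym_monos n d) in
     alg_gen {(\<lambda>y. coeff (charpoly_gen n d y) (m - k)) | k. 1 \<le> k \<and> k \<le> m})"

definition mtrace :: "complex mat \<Rightarrow> complex" where
  "mtrace A = (\<Sum>i<dim_row A. A $$ (i,i))"

definition tr_fun :: "nat \<Rightarrow> nat \<Rightarrow> (nat \<times> nat \<Rightarrow> complex) \<Rightarrow> complex" where
  "tr_fun n i y = mtrace (genmat n y ^\<^sub>m i)"

definition mpoly_eval :: "((nat \<Rightarrow>\<^sub>0 nat) \<Rightarrow>\<^sub>0 complex) \<Rightarrow> (nat \<Rightarrow> 'b \<Rightarrow> complex) \<Rightarrow> 'b \<Rightarrow> complex" where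
  "mpoly_eval p f y = (\<Sum>\<alpha>\<in>Poly_Mapping.keys p. Poly_Mapping.lookup p \<alpha> * (\<Prod>i\<in>Poly_Mapping.keys \<alpha>. f i y ^ Poly_Mapping.lookup \<alpha> i))"

definition alg_indep :: "nat set \<Rightarrow> (nat \<Rightarrow> 'b \<Rightarrow> complex) \<Rightarrow> bool" where
  "alg_indep I f \<longleftrightarrow> (\<forall>p. (\<forall>\<alpha>\<in>Poly_Mapping.keys p. Poly_Mapping.keys \<alpha> \<subseteq> I) \<longrightarrow> (\<forall>y. mpoly_eval p f y = 0) \<longrightarrow> p = 0)"

definition polyfun :: "nat \<Rightarrow> ((nat \<times> nat \<Rightarrow> complex) \<Rightarrow> complex) set" where
  "polyfun n = alg_gen {(\<lambda>y. y l) | l. l \<in> sl_index n}"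

(* coordinates of a traceless matrix A w.r.t. the basis: A = \<Sum>_l (coords n A l) g_l *)
definition coords :: "nat \<Rightarrow> complex mat \<Rightarrow> nat \<times> nat \<Rightarrow> complex" where
  "coords n A l = (case l of (i,j) \<Rightarrow>
     if (i,j) \<notin> sl_index n then 0
     else if i \<noteq> j then A $$ (i,j) else (\<Sum>t\<le>i. A $$ (t,t)))"

definition inv_ring :: "nat \<Rightarrow> ((nat \<times> nat \<Rightarrow> complex) \<Rightarrow> complex) set" where
  "inv_ring n = {f \<in> polyfun n. \<forall>g h y. g \<in> carrier_mat n n \<longrightarrow> h \<in> carrier_mat n n \<longrightarrow>
       g * h = 1\<^sub>m n \<longrightarrow> h * g = 1\<^sub>m n \<longrightarrow> det g = 1 \<longrightarrow>
       f (coords n (g * genmat n y * h)) = f y}"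

end

theory Submission
  imports Defs "HOL-Computational_Algebra.Polynomial_FPS" "Jordan_Normal_Form.Schur_Decomposition"
begin

text \<open>
  Write \<open>\<lambda>\<^sub>1, \<dots>, \<lambda>\<^sub>n\<close> for the eigenvalues of \<open>X\<close>. A Schur form \<open>X = P T P\<inverse>\<close> carries over to
  \<open>S\<^sup>d\<close>, where \<open>T\<close> acts triangularly in the lexicographic order of the monomials, so the
  characteristic polynomial of \<open>S\<^sup>d\<close> is the product of the \<open>x + \<Sum>\<^sub>j a\<^sub>j \<lambda>\<^sub>j\<close> over all exponent
  vectors \<open>a\<close> of degree \<open>d\<close>. By Newton's identities its coefficients generate the same algebra
  as the power sums of these weights. The \<open>i\<close>-th such power sum is a positive multiple of
  \<open>tr\<^sub>i\<close> plus a polynomial in \<open>tr\<^sub>1, \<dots>, tr\<^sub>i\<^sub>-\<^sub>1\<close>, so all of them together generate the same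
  algebra as all the traces; those with \<open>i > n\<close> are superfluous by Newton's identities, and
  \<open>tr\<^sub>1 = 0\<close>.

  An invariant is determined by its values on companion matrices, because a generic \<open>X\<close> is
  conjugate to its companion matrix; the entries of the latter are coefficients of the
  characteristic polynomial of \<open>X\<close>, hence polynomials in the traces. The traces are
  algebraically independent because diagonal matrices realise all values of
  \<open>(tr\<^sub>2, \<dots>, tr\<^sub>n)\<close>.
\<close>

subsection \<open>Generated algebras and Newton's identities\<close>

lemma alg_gen_subset:
  assumes "S \<subseteq> alg_gen T"
  shows "alg_gen S \<subseteq> alg_gen T"
proof
  fix f assume "f \<in> alg_gen S"
  then show "f \<in> alg_gen T"
    by induction (use assms in \<open>auto intro: alg_gen.intros\<close>)
qed

lemma alg_gen_mono: "S \<subseteq> T \<Longrightarrow> alg_gen S \<subseteq> alg_gen T"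
  by (rule alg_gen_subset) (auto intro: alg_gen.gen)

lemma alg_gen_cmult: "f \<in> alg_gen S \<Longrightarrow> (\<lambda>y. c * f y) \<in> alg_gen S"
  by (rule alg_gen.mult[OF alg_gen.const])

lemma alg_gen_uminus: "f \<in> alg_gen S \<Longrightarrow> (\<lambda>y. - f y) \<in> alg_gen S"
  using alg_gen_cmult[of f S "-1"] by simp

lemma alg_gen_diff: "f \<in> alg_gen S \<Longrightarrow> g \<in> alg_gen S \<Longrightarrow> (\<lambda>y. f y - g y) \<in> alg_gen S"
  using alg_gen.add[of f S "\<lambda>y. - g y"] alg_gen_uminus[of g S] by simp

lemma alg_gen_sum:
  "(\<And>j. j \<in> J \<Longrightarrow> f j \<in> alg_gen S) \<Longrightarrow> (\<lambda>y. \<Sum>j\<in>J. f j y) \<in> alg_gen S"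
  by (induction J rule: infinite_finite_induct) (auto intro: alg_gen.intros)

lemma alg_gen_prod:
  "(\<And>j. j \<in> J \<Longrightarrow> f j \<in> alg_gen S) \<Longrightarrow> (\<lambda>y. \<Prod>j\<in>J. f j y) \<in> alg_gen S"
  by (induction J rule: infinite_finite_induct) (auto intro: alg_gen.intros)

section \<open>Newton's identities for a finite family of complex numbers\<close>

definition power_sum :: "'j set \<Rightarrow> ('j \<Rightarrow> complex) \<Rightarrow> nat \<Rightarrow> complex" where
  "power_sum J x i = (\<Sum>j\<in>J. x j ^ i)"

text \<open>Defined through the generating function instead of sums over \<open>k\<close>-subsets,
  so that Newton's identities come out of a logarithmic derivative.\<close>

definition esym :: "'j set \<Rightarrow> ('j \<Rightarrow> complex) \<Rightarrow> nat \<Rightarrow> complex" where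
  "esym J x k = coeff (\<Prod>j\<in>J. [:1, x j:]) k"

lemma esym_0 [simp]: "esym J x 0 = 1"
  by (simp add: esym_def coeff_0 poly_0_coeff_0[symmetric] poly_prod)

lemma esym_eq_0: assumes "finite J" "card J < k" shows "esym J x k = 0"
proof -
  have "degree (\<Prod>j\<in>J. [:1, x j:]) \<le> (\<Sum>j\<in>J. degree [:1, x j:])"
    by (rule degree_prod_sum_le[OF assms(1), unfolded o_def])
  also have "\<dots> \<le> (\<Sum>j\<in>J. 1)" by (rule sum_mono) auto
  finally show ?thesis using assms(2) by (simp add: esym_def coeff_eq_0)
qed

text \<open>Logarithmic derivative of the product: the factor \<open>1 + x j * T\<close> contributes
  \<open>x j / (1 + x j * T)\<close>, and summing these geometric series over \<open>j\<close>
  produces the alternating power sums.\<close>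

lemma newton_fps:
  assumes "finite J"
  shows "fps_deriv (fps_of_poly (\<Prod>j\<in>J. [:1, x j:])) =
    fps_of_poly (\<Prod>j\<in>J. [:1, x j:]) * Abs_fps (\<lambda>i. (-1)^i * power_sum J x (Suc i))"
  using assms
proof (induction J)
  case empty
  then show ?case by (simp add: power_sum_def fps_eq_iff)
next
  case (insert a J)
  let ?F = "fps_of_poly (\<Prod>j\<in>J. [:1, x j:])"
  let ?L = "fps_of_poly [:1, x a:]"
  define G where "G = Abs_fps (\<lambda>i. (-1)^i * x a ^ Suc i)"
  have L: "?L = 1 + fps_const (x a) * fps_X"
    by (simp add: fps_of_poly_pCons)
  have G: "?L * G = fps_const (x a)"
    unfolding L by (rule fps_ext, case_tac n) (auto simp: G_def algebra_simps)
  have S: "Abs_fps (\<lambda>i. (-1)^i * power_sum (insert a J) x (Suc i)) =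
      Abs_fps (\<lambda>i. (-1)^i * power_sum J x (Suc i)) + G"
    using insert.hyps by (simp add: fps_eq_iff G_def power_sum_def algebra_simps)
  have dL: "fps_deriv ?L = fps_const (x a)" unfolding L by simp
  have P: "fps_of_poly (\<Prod>j\<in>insert a J. [:1, x j:]) = ?L * ?F"
    by (subst prod.insert[OF insert.hyps]) (rule fps_of_poly_mult)
  show ?case unfolding P S fps_deriv_mult dL insert.IH
    unfolding G[symmetric] by (simp add: algebra_simps)
qed

lemma newton_identity:
  assumes "finite J"
  shows "of_nat (Suc k) * esym J x (Suc k) =
    (\<Sum>i\<le>k. (-1)^(k-i) * esym J x i * power_sum J x (Suc (k - i)))"
proof -
  have "of_nat (Suc k) * esym J x (Suc k) =
      fps_nth (fps_deriv (fps_of_poly (\<Prod>j\<in>J. [:1, x j:]))) k"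
    by (simp add: esym_def)
  also have "\<dots> = (\<Sum>i\<le>k. (-1)^(k-i) * esym J x i * power_sum J x (Suc (k - i)))"
    unfolding newton_fps[OF assms] fps_mult_nth
    by (simp add: esym_def atLeast0AtMost algebra_simps)
  finally show ?thesis .
qed

text \<open>Newton's identity solved for the highest power sum, which is the \<open>i = 0\<close>
  term because \<open>esym J x 0 = 1\<close>.\<close>

lemma newton_power_sum:
  assumes "finite J"
  shows "power_sum J x (Suc k) * (-1)^k = of_nat (Suc k) * esym J x (Suc k) -
    (\<Sum>i\<in>{1..k}. (-1)^(k-i) * esym J x i * power_sum J x (Suc (k - i)))"
proof -
  have "{..k} = insert 0 {1..k}" by auto
  then show ?thesis unfolding newton_identity[OF assms] by simp
qed

text \<open>Newton's identity divided by \<open>k\<close>, which characteristic 0 permits; only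
  power sums up to index \<open>k\<close> enter.\<close>

lemma esym_in_alg_power_sum:
  fixes x :: "'b \<Rightarrow> 'j \<Rightarrow> complex"
  assumes "finite J"
  shows "(\<lambda>y. esym J (x y) k) \<in> alg_gen {\<lambda>y. power_sum J (x y) i | i. 1 \<le> i \<and> i \<le> k}"
proof (induction k rule: less_induct)
  case (less k)
  show ?case
  proof (cases k)
    case 0
    then show ?thesis by (auto intro: alg_gen.const)
  next
    case (Suc l)
    have eq: "(\<lambda>y. esym J (x y) k) = (\<lambda>y. (1 / of_nat (Suc l)) *
        (\<Sum>i\<le>l. (-1)^(l-i) * (esym J (x y) i * power_sum J (x y) (Suc (l - i)))))"
      unfolding Suc using newton_identity[OF assms, of l]
      by (intro ext) (simp add: field_simps del: of_nat_Suc)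
    have e: "(\<lambda>y. esym J (x y) i) \<in> alg_gen {\<lambda>y. power_sum J (x y) i | i. 1 \<le> i \<and> i \<le> k}"
      if "i \<le> l" for i
      by (rule subsetD[OF alg_gen_mono less]) (use that Suc in auto)
    have p: "(\<lambda>y. power_sum J (x y) (Suc (l - i))) \<in>
        alg_gen {\<lambda>y. power_sum J (x y) i | i. 1 \<le> i \<and> i \<le> k}" if "i \<le> l" for i
      by (rule alg_gen.gen) (use Suc in auto)
    show ?thesis unfolding eq
      by (intro alg_gen_cmult alg_gen_sum alg_gen.mult e p) auto
  qed
qed

text \<open>Strong induction over Newton's identity; elementary symmetric functions past
  \<open>card J\<close> vanish, so finitely many generators serve every \<open>i\<close>.\<close>

lemma power_sum_in_alg_esym:
  fixes x :: "'b \<Rightarrow> 'j \<Rightarrow> complex"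
  assumes "finite J"
  shows "(\<lambda>y. power_sum J (x y) i) \<in> alg_gen {\<lambda>y. esym J (x y) k | k. 1 \<le> k \<and> k \<le> card J}"
    (is "_ \<in> alg_gen ?E")
proof (induction i rule: less_induct)
  case (less i)
  have e: "(\<lambda>y. esym J (x y) k) \<in> alg_gen ?E" for k
  proof -
    consider "k = 0" | "1 \<le> k \<and> k \<le> card J" | "card J < k" by linarith
    then show ?thesis
    proof cases
      case 2
      then show ?thesis by (intro alg_gen.gen) auto
    qed (auto simp: esym_eq_0 assms intro: alg_gen.const)
  qed
  show ?case
  proof (cases i)
    case 0
    then show ?thesis by (auto simp: power_sum_def intro: alg_gen.const)
  next
    case (Suc l)
    have sgn: "(-1)^l * (-1)^l = (1::complex)"
      by (simp flip: power_add)
    have eq: "(\<lambda>y. power_sum J (x y) i) = (\<lambda>y. (-1)^l * (of_nat (Suc l) * esym J (x y) (Suc l) -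
        (\<Sum>i\<in>{1..l}. (-1)^(l-i) * (esym J (x y) i * power_sum J (x y) (Suc (l - i))))))"
      unfolding Suc
    proof
      fix y
      have "power_sum J (x y) (Suc l) = (-1)^l * (power_sum J (x y) (Suc l) * (-1)^l)"
        by (metis (no_types, lifting) sgn mult.assoc mult.commute mult_1)
      then show "power_sum J (x y) (Suc l) = (-1)^l * (of_nat (Suc l) * esym J (x y) (Suc l) -
        (\<Sum>i\<in>{1..l}. (-1)^(l-i) * (esym J (x y) i * power_sum J (x y) (Suc (l - i)))))"
        unfolding newton_power_sum[OF assms] mult.assoc .
    qed
    show ?thesis unfolding eq
      by (intro alg_gen_cmult alg_gen_diff alg_gen_sum alg_gen.mult e less) (use Suc in auto)
  qed
qed

text \<open>Composing the two conversions discards all power sums of index above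
  \<open>card J\<close>; later this removes the traces of high powers.\<close>

lemma power_sum_in_alg_power_sum:
  fixes x :: "'b \<Rightarrow> 'j \<Rightarrow> complex"
  assumes "finite J"
  shows "(\<lambda>y. power_sum J (x y) i) \<in> alg_gen {\<lambda>y. power_sum J (x y) i | i. 1 \<le> i \<and> i \<le> card J}"
proof -
  have "(\<lambda>y. esym J (x y) k) \<in> alg_gen {\<lambda>y. power_sum J (x y) i | i. 1 \<le> i \<and> i \<le> card J}"
    if "k \<le> card J" for k
    by (rule subsetD[OF alg_gen_mono esym_in_alg_power_sum[OF assms]]) (use that in auto)
  then show ?thesis
    by (intro subsetD[OF alg_gen_subset power_sum_in_alg_esym[OF assms]]) auto
qed

subsection \<open>Power sums of the weights of the symmetric power\<close>

lemma set_sym_monos: "set (sym_monos n d) = {a. length a = n \<and> sum_list a = d}"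
proof (induction n arbitrary: d)
  case (Suc n)
  show ?case
  proof (intro Set.set_eqI iffI)
    fix a assume "a \<in> {a. length a = Suc n \<and> sum_list a = d}"
    then obtain k b where "a = k # b" "length b = n" "k + sum_list b = d"
      by (cases a) auto
    then show "a \<in> set (sym_monos (Suc n) d)"
      by (auto simp: Suc image_iff intro!: bexI[of _ k] simp del: upt_Suc)
  qed (auto simp: Suc simp del: upt_Suc)
qed auto

text \<open>The eigenvalue of the diagonal matrix with entries \<open>x\<close> on the monomial with
  exponent vector \<open>a\<close>.\<close>

definition weight :: "nat \<Rightarrow> (nat \<Rightarrow> complex) \<Rightarrow> nat list \<Rightarrow> complex" where
  "weight n x a = (\<Sum>j<n. of_nat (a ! j) * x j)"

definition weight_sum :: "nat \<Rightarrow> nat \<Rightarrow> (nat \<Rightarrow> complex) \<Rightarrow> nat \<Rightarrow> complex" where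
  "weight_sum n d x i = (\<Sum>a\<in>set (sym_monos n d). weight n x a ^ i)"

lemma weight_update:
  assumes "length b = n" "j < n"
  shows "weight n x (b[j := b ! j + k]) = weight n x b + of_nat k * x j"
proof -
  have "weight n x (b[j := b ! j + k]) =
      (\<Sum>i<n. of_nat (b ! i) * x i + (if i = j then of_nat k * x i else 0))"
    unfolding weight_def using assms by (intro sum.cong) (auto simp: nth_list_update algebra_simps)
  then show ?thesis using assms by (simp add: sum.distrib weight_def)
qed

text \<open>Each \<open>a\<close> of degree \<open>d\<close> is counted once for every way of splitting off a power
  \<open>e\<^sub>j\<^sup>k\<close>, \<open>1 \<le> k \<le> a\<^sub>j\<close>, hence \<open>d\<close> times.\<close>

lemma weight_sum_recurrence:
  "of_nat d * weight_sum n d x i =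
    (\<Sum>k\<in>{1..d}. \<Sum>j<n. \<Sum>b\<in>set (sym_monos n (d - k)). (weight n x b + of_nat k * x j) ^ i)"
proof -
  have "of_nat d * weight_sum n d x i =
      (\<Sum>a\<in>set (sym_monos n d). \<Sum>j<n. of_nat (a ! j) * weight n x a ^ i)"
  proof -
    have "of_nat d * weight n x a ^ i = (\<Sum>j<n. of_nat (a ! j) * weight n x a ^ i)"
      if "a \<in> set (sym_monos n d)" for a
    proof -
      from that have "(\<Sum>j<n. a ! j) = d"
        by (auto simp: set_sym_monos sum_list_sum_nth atLeast0LessThan)
      then have "of_nat d = (\<Sum>j<n. of_nat (a ! j) :: complex)" by (simp flip: of_nat_sum)
      then show ?thesis by (simp add: sum_distrib_right)
    qed
    then show ?thesis by (simp add: weight_sum_def sum_distrib_left)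
  qed
  \<comment> \<open>The factor \<open>a ! j\<close> is rewritten as the number of \<open>k\<close>
    with \<open>1 \<le> k\<close> and \<open>k \<le> a ! j\<close>.\<close>
  also have "\<dots> = (\<Sum>a\<in>set (sym_monos n d). \<Sum>j<n. \<Sum>k\<in>{1..d}. if k \<le> a ! j then weight n x a ^ i else 0)"
  proof (intro sum.cong refl)
    fix a j assume a: "a \<in> set (sym_monos n d)" and j: "j \<in> {..<n}"
    then have "a ! j \<le> d" using elem_le_sum_list[of j a] by (auto simp: set_sym_monos)
    then have "{1..d} \<inter> {k. k \<le> a ! j} = {1..a ! j}" by auto
    then show "of_nat (a ! j) * weight n x a ^ i = (\<Sum>k\<in>{1..d}. if k \<le> a ! j then weight n x a ^ i else 0)"
      by (simp add: sum.If_cases)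
  qed
  also have "\<dots> = (\<Sum>j<n. \<Sum>a\<in>set (sym_monos n d). \<Sum>k\<in>{1..d}. if k \<le> a ! j then weight n x a ^ i else 0)"
    by (rule sum.swap)
  also have "\<dots> = (\<Sum>j<n. \<Sum>k\<in>{1..d}. \<Sum>a\<in>set (sym_monos n d). if k \<le> a ! j then weight n x a ^ i else 0)"
    by (intro sum.cong refl sum.swap)
  also have "\<dots> = (\<Sum>k\<in>{1..d}. \<Sum>j<n. \<Sum>a\<in>set (sym_monos n d). if k \<le> a ! j then weight n x a ^ i else 0)"
    by (rule sum.swap)
  also have "\<dots> = (\<Sum>k\<in>{1..d}. \<Sum>j<n. \<Sum>b\<in>set (sym_monos n (d - k)). (weight n x b + of_nat k * x j) ^ i)"
  proof (rule sum.cong[OF refl], rule sum.cong[OF refl])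
    fix k j assume k: "k \<in> {1..d}" and j: "j \<in> {..<n}"
    have "(\<Sum>a\<in>set (sym_monos n d). if k \<le> a ! j then weight n x a ^ i else 0) =
        (\<Sum>a\<in>{a\<in>set (sym_monos n d). k \<le> a ! j}. weight n x a ^ i)"
      by (rule sum.inter_filter[symmetric]) auto
    also have "\<dots> = (\<Sum>b\<in>set (sym_monos n (d - k)). (weight n x b + of_nat k * x j) ^ i)"
    \<comment> \<open>Dividing by the \<open>k\<close>-th power of \<open>e_j\<close> is a bijection
      onto the monomials of degree \<open>d - k\<close> and lowers the weight by
      \<open>k * x j\<close>.\<close>
    proof (rule sum.reindex_bij_witness[where i = "\<lambda>b. b[j := b ! j + k]" and j = "\<lambda>a. a[j := a ! j - k]"])
      fix a assume a: "a \<in> {a \<in> set (sym_monos n d). k \<le> a ! j}"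
      then have le: "a ! j \<le> sum_list a"
        using j elem_le_sum_list[of j a] by (auto simp: set_sym_monos)
      show "a[j := a ! j - k] \<in> set (sym_monos n (d - k))"
        using a j k le by (auto simp: set_sym_monos sum_list_update)
      show "(a[j := a ! j - k])[j := a[j := a ! j - k] ! j + k] = a"
        using a j by (auto simp: set_sym_monos)
      then show "(weight n x (a[j := a ! j - k]) + of_nat k * x j) ^ i = weight n x a ^ i"
        using weight_update[of "a[j := a ! j - k]" n j x k] a j by (auto simp: set_sym_monos)
    next
      fix b assume b: "b \<in> set (sym_monos n (d - k))"
      then have le: "b ! j \<le> sum_list b"
        using j elem_le_sum_list[of j b] by (auto simp: set_sym_monos)
      show "(b[j := b ! j + k])[j := b[j := b ! j + k] ! j - k] = b"
        using b j by (auto simp: set_sym_monos)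
      show "b[j := b ! j + k] \<in> {a \<in> set (sym_monos n d). k \<le> a ! j}"
        using b j k le by (auto simp: set_sym_monos sum_list_update)
    qed
    finally show "(\<Sum>a\<in>set (sym_monos n d). if k \<le> a ! j then weight n x a ^ i else 0) = \<dots>" .
  qed
  finally show ?thesis .
qed

text \<open>The binomial theorem separates \<open>b\<close> from \<open>j\<close>. The term
  \<open>l = i\<close> involves the same \<open>i\<close> in lower degree, \<open>l = 0\<close>
  gives the \<open>i\<close>-th power sum, and all others have smaller indices in both
  factors.\<close>

lemma weight_sum_recurrence_binomial:
  "of_nat d * weight_sum n d x i =
    (\<Sum>k\<in>{1..d}. \<Sum>l\<le>i. of_nat (i choose l) * of_nat k ^ (i - l) *
      (weight_sum n (d - k) x l * power_sum {..<n} x (i - l)))"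
  unfolding weight_sum_recurrence
proof (rule sum.cong[OF refl])
  fix k
  have "(\<Sum>j<n. \<Sum>b\<in>set (sym_monos n (d - k)). (weight n x b + of_nat k * x j) ^ i) =
      (\<Sum>j<n. \<Sum>b\<in>set (sym_monos n (d - k)). \<Sum>l\<le>i. of_nat (i choose l) * of_nat k ^ (i - l) *
        (weight n x b ^ l * x j ^ (i - l)))"
    by (simp add: binomial_ring power_mult_distrib ac_simps)
  also have "\<dots> = (\<Sum>j<n. \<Sum>l\<le>i. \<Sum>b\<in>set (sym_monos n (d - k)). of_nat (i choose l) * of_nat k ^ (i - l) *
        (weight n x b ^ l * x j ^ (i - l)))"
    by (intro sum.cong refl sum.swap)
  also have "\<dots> = (\<Sum>l\<le>i. \<Sum>j<n. \<Sum>b\<in>set (sym_monos n (d - k)). of_nat (i choose l) * of_nat k ^ (i - l) *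
        (weight n x b ^ l * x j ^ (i - l)))"
    by (rule sum.swap)
  also have "\<dots> = (\<Sum>l\<le>i. of_nat (i choose l) * of_nat k ^ (i - l) *
      (weight_sum n (d - k) x l * power_sum {..<n} x (i - l)))"
  proof (rule sum.cong[OF refl])
    fix l
    have "weight_sum n (d - k) x l * power_sum {..<n} x (i - l) =
        (\<Sum>j<n. \<Sum>b\<in>set (sym_monos n (d - k)). weight n x b ^ l * x j ^ (i - l))"
      unfolding weight_sum_def power_sum_def sum_product by (rule sum.swap)
    then show "(\<Sum>j<n. \<Sum>b\<in>set (sym_monos n (d - k)). of_nat (i choose l) * of_nat k ^ (i - l) *
        (weight n x b ^ l * x j ^ (i - l))) = of_nat (i choose l) * of_nat k ^ (i - l) *
      (weight_sum n (d - k) x l * power_sum {..<n} x (i - l))"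
      by (simp add: sum_distrib_left)
  qed
  finally show "(\<Sum>j<n. \<Sum>b\<in>set (sym_monos n (d - k)). (weight n x b + of_nat k * x j) ^ i) = \<dots>" .
qed

abbreviation power_sums_below :: "nat \<Rightarrow> ('b \<Rightarrow> nat \<Rightarrow> complex) \<Rightarrow> nat \<Rightarrow> ('b \<Rightarrow> complex) set" where
  "power_sums_below n x i \<equiv> alg_gen {\<lambda>y. power_sum {..<n} (x y) k | k. 1 \<le> k \<and> k < i}"

lemma sym_monos_degree_0: "set (sym_monos n 0) = {replicate n 0}"
proof (intro equalityI subsetI)
  fix a assume "a \<in> set (sym_monos n 0)"
  then have "length a = n" "\<forall>x\<in>set a. x = 0" by (simp_all add: set_sym_monos)
  from replicate_length_same[OF this(2)] this(1) show "a \<in> {replicate n 0}" by simp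
qed (simp add: set_sym_monos sum_list_replicate)

text \<open>Induction on \<open>d\<close> through the recurrence. Keeping the coefficient real and
  nonnegative excludes cancellation when the contributions of all \<open>k\<close> are added, and
  the term \<open>k = d\<close> is positive.\<close>

lemma weight_sum_leading_term:
  fixes x :: "'b \<Rightarrow> nat \<Rightarrow> complex"
  assumes "1 \<le> i" "1 \<le> n"
  shows "\<exists>c\<ge>0. (1 \<le> d \<longrightarrow> 0 < c) \<and>
    (\<lambda>y. weight_sum n d (x y) i - of_real c * power_sum {..<n} (x y) i) \<in> power_sums_below n x i"
  using assms
proof (induction d arbitrary: i rule: less_induct)
  case (less d)
  show ?case
  proof (cases d)
    case 0
    have "(\<lambda>y. weight_sum n d (x y) i - of_real 0 * power_sum {..<n} (x y) i) = (\<lambda>y. 0)"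
      using less.prems by (auto simp: weight_sum_def 0 sym_monos_degree_0 weight_def)
    then show ?thesis using 0 by (intro exI[of _ 0]) (auto intro: alg_gen.const)
  next
    case (Suc e)
    have mono: "power_sums_below n x j \<subseteq> power_sums_below n x i" if "j \<le> i" for j
      by (rule alg_gen_mono) (use that in auto)
    have p_in: "(\<lambda>y. power_sum {..<n} (x y) l) \<in> power_sums_below n x i" if "1 \<le> l" "l < i" for l
      by (rule alg_gen.gen) (use that in auto)
    have H_in: "(\<lambda>y. weight_sum n (d - k) (x y) l) \<in> power_sums_below n x i"
      if kl: "1 \<le> k" "1 \<le> l" "l < i" for k l
    proof -
      obtain c where c: "(\<lambda>y. weight_sum n (d - k) (x y) l - of_real c * power_sum {..<n} (x y) l)
          \<in> power_sums_below n x l"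
        using less.IH[of "d - k" l, OF _ kl(2) less.prems(2)] kl(1) Suc by auto
      have "(\<lambda>y. (weight_sum n (d - k) (x y) l - of_real c * power_sum {..<n} (x y) l)
          + of_real c * power_sum {..<n} (x y) l) \<in> power_sums_below n x i"
        by (intro alg_gen.add alg_gen_cmult p_in subsetD[OF mono c]) (use kl in auto)
      then show ?thesis by simp
    qed
    have "\<forall>k\<in>{1..d}. \<exists>c. 0 \<le> c \<and> (\<lambda>y. weight_sum n (d - k) (x y) i - of_real c * power_sum {..<n} (x y) i)
        \<in> power_sums_below n x i"
    proof
      fix k assume "k \<in> {1..d}"
      then have "d - k < d" by auto
      from less.IH[OF this less.prems]
      show "\<exists>c. 0 \<le> c \<and> (\<lambda>y. weight_sum n (d - k) (x y) i - of_real c * power_sum {..<n} (x y) i)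
        \<in> power_sums_below n x i" by blast
    qed
    from bchoice[OF this]
    obtain c where c: "\<And>k. k \<in> {1..d} \<Longrightarrow> 0 \<le> c k"
      "\<And>k. k \<in> {1..d} \<Longrightarrow> (\<lambda>y. weight_sum n (d - k) (x y) i - of_real (c k) * power_sum {..<n} (x y) i)
        \<in> power_sums_below n x i"
      by blast
    \<comment> \<open>\<open>m k\<close> is the value of \<open>weight_sum\<close> at exponent 0.
      \<open>C\<close> collects the multiples of the \<open>i\<close>-th power sum from
      \<open>l = i\<close> and \<open>l = 0\<close>; it is \<open>d\<close> times the coefficient
      sought.\<close>
    define m where "m k = real (card (set (sym_monos n (d - k))))" for k
    define C where "C = (\<Sum>k\<in>{1..d}. real n * c k + real k ^ i * m k)"
    have "C \<ge> real n * c d + real d ^ i * m d"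
      unfolding C_def
      by (rule member_le_sum[of d "{1..d}" "\<lambda>k. real n * c k + real k ^ i * m k"])
        (use Suc c in \<open>auto simp: m_def\<close>)
    moreover have "real n * c d \<ge> 0" using c(1)[of d] Suc by simp
    moreover have "real d ^ i * m d > 0"
      using Suc by (simp add: m_def sym_monos_degree_0)
    ultimately have C: "C > 0" by linarith
    \<comment> \<open>The middle terms \<open>0 < l < i\<close>, in which both factors already lie
      in the algebra of lower power sums.\<close>
    define R where "R k y = (\<Sum>l\<in>{1..<i}. of_nat (i choose l) * of_nat k ^ (i - l) *
      (weight_sum n (d - k) (x y) l * power_sum {..<n} (x y) (i - l)))" for k y
    have split: "{..i} = insert 0 (insert i {1..<i})" using less.prems by auto
    have step: "of_nat d * weight_sum n d (x y) i = (\<Sum>k\<in>{1..d}. of_nat n * weight_sum n (d - k) (x y) i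
        + of_real (real k ^ i * m k) * power_sum {..<n} (x y) i + R k y)" for y
      unfolding weight_sum_recurrence_binomial R_def split
      using less.prems
      by (intro sum.cong refl) (auto simp: weight_sum_def[of _ _ _ 0] power_sum_def[of _ _ 0] m_def)
    have eq: "weight_sum n d (x y) i - of_real (C / real d) * power_sum {..<n} (x y) i =
        of_real (1 / real d) * (\<Sum>k\<in>{1..d}. of_nat n * (weight_sum n (d - k) (x y) i
          - of_real (c k) * power_sum {..<n} (x y) i) + R k y)" for y
    proof -
      have "of_nat d * weight_sum n d (x y) i - of_real C * power_sum {..<n} (x y) i =
          (\<Sum>k\<in>{1..d}. of_nat n * (weight_sum n (d - k) (x y) i
          - of_real (c k) * power_sum {..<n} (x y) i) + R k y)"
        unfolding step C_def of_real_sum sum_distrib_right sum_subtractf[symmetric]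
        by (rule sum.cong[OF refl]) (simp add: algebra_simps)
      then show ?thesis using Suc by (simp add: field_simps del: of_nat_Suc)
    qed
    have "(\<lambda>y. R k y) \<in> power_sums_below n x i" if "k \<in> {1..d}" for k
      unfolding R_def using that by (intro alg_gen_sum alg_gen_cmult alg_gen.mult H_in p_in) auto
    then have "(\<lambda>y. weight_sum n d (x y) i - of_real (C / real d) * power_sum {..<n} (x y) i)
        \<in> power_sums_below n x i"
      unfolding eq by (intro alg_gen_cmult alg_gen_sum alg_gen.add c)
    then show ?thesis using C Suc by (intro exI[of _ "C / real d"]) auto
  qed
qed

text \<open>The passage between the two families is triangular with nonzero diagonal coefficients,
  hence it can be inverted one index at a time.\<close>

lemma alg_gen_weight_sums:
  fixes x :: "'b \<Rightarrow> nat \<Rightarrow> complex"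
  assumes "1 \<le> d" "1 \<le> n"
  shows "alg_gen {\<lambda>y. weight_sum n d (x y) i | i. 1 \<le> i} = alg_gen {\<lambda>y. power_sum {..<n} (x y) i | i. 1 \<le> i}"
    (is "alg_gen ?H = alg_gen ?P")
proof
  show "alg_gen ?H \<subseteq> alg_gen ?P"
  proof (rule alg_gen_subset, clarify)
    fix i :: nat assume i: "1 \<le> i"
    obtain c where c: "(\<lambda>y. weight_sum n d (x y) i - of_real c * power_sum {..<n} (x y) i) \<in> power_sums_below n x i"
      using weight_sum_leading_term[OF i assms(2)] by blast
    have "power_sums_below n x i \<subseteq> alg_gen ?P" by (rule alg_gen_mono) auto
    moreover have "(\<lambda>y. power_sum {..<n} (x y) i) \<in> alg_gen ?P" by (rule alg_gen.gen) (use i in auto)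
    ultimately have "(\<lambda>y. (weight_sum n d (x y) i - of_real c * power_sum {..<n} (x y) i)
        + of_real c * power_sum {..<n} (x y) i) \<in> alg_gen ?P"
      using c by (intro alg_gen.add alg_gen_cmult) auto
    then show "(\<lambda>y. weight_sum n d (x y) i) \<in> alg_gen ?P" by simp
  qed
next
  have "(\<lambda>y. power_sum {..<n} (x y) i) \<in> alg_gen ?H" if "1 \<le> i" for i
    using that
  proof (induction i rule: less_induct)
    case (less i)
    obtain c where c: "c > 0"
      "(\<lambda>y. weight_sum n d (x y) i - of_real c * power_sum {..<n} (x y) i) \<in> power_sums_below n x i"
      using weight_sum_leading_term[OF less.prems assms(2)] assms(1) by blast
    have "power_sums_below n x i \<subseteq> alg_gen ?H" by (rule alg_gen_subset, clarify, rule less.IH)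
    moreover have "(\<lambda>y. weight_sum n d (x y) i) \<in> alg_gen ?H" by (rule alg_gen.gen) (use less in auto)
    ultimately have "(\<lambda>y. of_real (1 / c) * (weight_sum n d (x y) i -
        (weight_sum n d (x y) i - of_real c * power_sum {..<n} (x y) i))) \<in> alg_gen ?H"
      using c by - (rule alg_gen_cmult, rule alg_gen_diff, auto)
    then show ?case using c by simp
  qed
  then show "alg_gen ?P \<subseteq> alg_gen ?H" by (intro alg_gen_subset) auto
qed

subsection \<open>Linear independence of monomials\<close>

text \<open>Base-\<open>N\<close> value with the most significant digit first. For digits below
  \<open>N\<close> it turns the lexicographic order into a number, which serves both for
  triangularity and as exponent in Kronecker's substitution.\<close>

fun radix :: "nat \<Rightarrow> nat list \<Rightarrow> nat" where
  "radix N [] = 0"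
| "radix N (x # xs) = x * N ^ length xs + radix N xs"

lemma radix_less: "\<forall>x\<in>set xs. x < N \<Longrightarrow> radix N xs < N ^ length xs"
proof (induction xs)
  case (Cons x xs)
  then have "radix N (x # xs) < (x + 1) * N ^ length xs" by simp
  also have "\<dots> \<le> N * N ^ length xs" using Cons.prems by (intro mult_right_mono) auto
  finally show ?case by simp
qed simp

lemma radix_less_Cons:
  assumes "\<forall>x\<in>set xs. x < N" "length xs = length ys" "k < l"
  shows "radix N (k # xs) < radix N (l # ys)"
proof -
  have "radix N (k # xs) < (k + 1) * N ^ length xs" using radix_less[OF assms(1)] by simp
  also have "\<dots> \<le> l * N ^ length ys" using assms by (intro mult_mono) auto
  finally show ?thesis by simp
qed

lemma radix_inj:
  assumes "\<forall>x\<in>set xs. x < N" "\<forall>x\<in>set ys. x < N" "length xs = length ys" "radix N xs = radix N ys"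
  shows "xs = ys"
  using assms
proof (induction xs ys rule: list_induct2')
  case (4 x xs y ys)
  have "x = y"
    using radix_less_Cons[of xs N ys x y] radix_less_Cons[of ys N xs y x] 4 by (metis length_Cons list.set_intros(2) nat_neq_iff old.nat.inject)
  then show ?case using 4 by auto
qed auto

lemma sym_monos_entry_le: "a \<in> set (sym_monos n d) \<Longrightarrow> x \<in> set a \<Longrightarrow> x \<le> d"
  using member_le_sum_list[of x a] by (simp add: set_sym_monos)

text \<open>Blocks with a larger first entry come later, and within a block the order is inherited
  from the tails.\<close>

lemma sorted_wrt_radix_sym_monos:
  "d < N \<Longrightarrow> sorted_wrt (\<lambda>a b. radix N a < radix N b) (sym_monos n d)"
proof (induction n arbitrary: d)
  case (Suc n)
  note IH = Suc.IH
  \<comment> \<open>Induction on the number \<open>e\<close> of blocks while \<open>d\<close> stays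
    fixed.\<close>
  have "sorted_wrt (\<lambda>a b. radix N a < radix N b) (concat (map (\<lambda>k. map ((#) k) (sym_monos n (d - k))) [0..<e]))" for e
  proof (induction e)
    case (Suc e)
    have "radix N (k # a) < radix N (e # b)"
      if "k < e" "a \<in> set (sym_monos n (d - k))" "b \<in> set (sym_monos n (d - e))" for k a b
      by (rule radix_less_Cons) (use that sym_monos_entry_le[OF that(2)] \<open>d < N\<close> in \<open>force simp: set_sym_monos\<close>)+
    moreover have "sorted_wrt (\<lambda>a b. radix N a < radix N b) (map ((#) e) (sym_monos n (d - e)))"
    proof -
      have "sorted_wrt (\<lambda>a b. radix N a < radix N b) (sym_monos n (d - e))"
        using \<open>d < N\<close> by (intro IH) simp
      then show ?thesis unfolding sorted_wrt_map
        by (rule sorted_wrt_mono_rel[rotated]) (auto simp: set_sym_monos)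
    qed
    ultimately show ?case using Suc.IH by (auto simp: sorted_wrt_append)
  qed simp
  then show ?case by (simp del: upt_Suc)
qed simp

lemma radix_sym_monos_less:
  "r < s \<Longrightarrow> s < length (sym_monos n d) \<Longrightarrow> radix (d + 1) (sym_monos n d ! r) < radix (d + 1) (sym_monos n d ! s)"
  using sorted_wrt_radix_sym_monos[of d "d + 1" n] by (auto simp: sorted_wrt_iff_nth_less)

lemma distinct_sym_monos: "distinct (sym_monos n d)"
  unfolding distinct_conv_nth
proof (intro allI impI notI)
  fix i j assume "i < length (sym_monos n d)" "j < length (sym_monos n d)" "i \<noteq> j"
    and "sym_monos n d ! i = sym_monos n d ! j"
  then show False
    using radix_sym_monos_less[of i j n d] radix_sym_monos_less[of j i n d] by (cases "i < j") auto
qed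

definition monomial :: "nat list \<Rightarrow> (nat \<Rightarrow> complex) \<Rightarrow> complex" where
  "monomial a z = (\<Prod>j<length a. z j ^ (a ! j))"

text \<open>Kronecker's substitution: the place values of base \<open>N\<close> become exponents of
  a single variable \<open>t\<close>.\<close>

lemma monomial_radix: "monomial a (\<lambda>j. t ^ (N ^ (length a - Suc j))) = t ^ radix N a"
proof (induction a)
  case (Cons x a)
  have "monomial (x # a) (\<lambda>j. t ^ (N ^ (length (x # a) - Suc j))) =
      (t ^ N ^ length a) ^ x * monomial a (\<lambda>j. t ^ (N ^ (length a - Suc j)))"
    unfolding monomial_def length_Cons prod.lessThan_Suc_shift by simp
  also have "\<dots> = t ^ (x * N ^ length a) * t ^ radix N a"
    unfolding Cons.IH by (simp only: power_mult[symmetric] mult.commute)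
  finally show ?case by (simp add: power_add)
qed (simp add: monomial_def)

text \<open>With base \<open>d + 1\<close>, above all exponents, Kronecker's substitution maps
  distinct monomials to distinct powers of \<open>t\<close>, so the relation becomes a zero
  polynomial in one variable.\<close>

lemma monomials_independent:
  assumes "\<And>z. (\<Sum>r<length (sym_monos n d). v r * monomial (sym_monos n d ! r) z) = 0"
    and "s < length (sym_monos n d)"
  shows "v s = 0"
proof -
  let ?B = "sym_monos n d"
  define p where "p = (\<Sum>r<length ?B. monom (v r) (radix (d + 1) (?B ! r)))"
  have "poly p t = 0" for t
  proof -
    have "poly p t = (\<Sum>r<length ?B. v r * monomial (?B ! r) (\<lambda>j. t ^ ((d + 1) ^ (n - Suc j))))"
      unfolding p_def poly_sum
    proof (rule sum.cong[OF refl])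
      fix r assume "r \<in> {..<length ?B}"
      then have "length (?B ! r) = n" using nth_mem[of r ?B] by (auto simp: set_sym_monos)
      then show "poly (monom (v r) (radix (d + 1) (?B ! r))) t =
          v r * monomial (?B ! r) (\<lambda>j. t ^ ((d + 1) ^ (n - Suc j)))"
        using monomial_radix[of "?B ! r" t "d + 1"] by (simp add: poly_monom)
    qed
    then show ?thesis using assms(1) by simp
  qed
  then have "p = 0" using poly_all_0_iff_0 by blast
  then have "0 = coeff p (radix (d + 1) (?B ! s))" by simp
  also have "\<dots> = (\<Sum>r<length ?B. if r = s then v r else 0)"
    unfolding p_def coeff_sum coeff_monom using assms(2)
    by (intro sum.cong refl) (metis lessThan_iff linorder_neqE_nat order_less_irrefl radix_sym_monos_less)
  also have "\<dots> = v s" using assms(2) by simp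
  finally show ?thesis by simp
qed

subsection \<open>Functoriality of the symmetric power\<close>

text \<open>The basis vectors \<open>e\<^sub>1, \<dots>, e\<^sub>n\<close> are treated as the coordinates of a point \<open>z\<close>, so
  that a matrix \<open>P\<close> acting on them moves \<open>z\<close> to \<open>P\<^sup>T z\<close>.\<close>

definition subst_lin :: "nat \<Rightarrow> complex mat \<Rightarrow> (nat \<Rightarrow> complex) \<Rightarrow> nat \<Rightarrow> complex" where
  "subst_lin n P z j = (\<Sum>i<n. P $$ (i,j) * z i)"

lemma length_sym_monos_nth: "r < length (sym_monos n d) \<Longrightarrow> length (sym_monos n d ! r) = n"
  using nth_mem[of r "sym_monos n d"] by (auto simp: set_sym_monos)

lemma monomial_cong: "(\<And>j. j < length a \<Longrightarrow> z j = w j) \<Longrightarrow> monomial a z = monomial a w"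
  by (simp add: monomial_def)

lemma monomial_incr:
  assumes "i < length a"
  shows "monomial (a[i := Suc (a ! i)]) z = z i * monomial a z"
proof -
  have "monomial (a[i := Suc (a ! i)]) z = (\<Prod>j<length a. (if j = i then z j else 1) * z j ^ (a ! j))"
    unfolding monomial_def by (intro prod.cong) (auto simp: nth_list_update)
  also have "\<dots> = z i * monomial a z"
    using assms by (simp add: prod.distrib monomial_def)
  finally show ?thesis .
qed

text \<open>The product rule along the direction \<open>w\<close>; the guard
  \<open>1 \<le> a ! k\<close> matches the one in \<open>symrep\<close>.\<close>

lemma DERIV_monomial:
  "((\<lambda>t. monomial a (\<lambda>j. z j + t * w j)) has_field_derivative
    (\<Sum>k<length a. if 1 \<le> a ! k then of_nat (a ! k) * w k * monomial (a[k := a ! k - 1]) z else 0)) (at 0)"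
proof -
  have d: "((\<lambda>t. (z j + t * w j) ^ (a ! j)) has_field_derivative
      of_nat (a ! j) * w j * z j ^ (a ! j - 1)) (at 0)" for j
    by (auto intro!: derivative_eq_intros)
  have "((\<lambda>t. monomial a (\<lambda>j. z j + t * w j)) has_field_derivative
      (\<Sum>k<length a. of_nat (a ! k) * w k * z k ^ (a ! k - 1) *
        (\<Prod>j\<in>{..<length a} - {k}. (z j + 0 * w j) ^ (a ! j)))) (at 0)"
    unfolding monomial_def by (rule has_field_derivative_prod[OF d])
  also have "(\<Sum>k<length a. of_nat (a ! k) * w k * z k ^ (a ! k - 1) *
        (\<Prod>j\<in>{..<length a} - {k}. (z j + 0 * w j) ^ (a ! j))) =
      (\<Sum>k<length a. if 1 \<le> a ! k then of_nat (a ! k) * w k * monomial (a[k := a ! k - 1]) z else 0)"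
  proof (rule sum.cong[OF refl])
    fix k assume "k \<in> {..<length a}"
    then have "monomial (a[k := a ! k - 1]) z =
        z k ^ (a ! k - 1) * (\<Prod>j\<in>{..<length a} - {k}. z j ^ (a ! j))"
      unfolding monomial_def by (subst prod.remove[of _ k]) (auto simp: nth_list_update)
    then show "of_nat (a ! k) * w k * z k ^ (a ! k - 1) *
        (\<Prod>j\<in>{..<length a} - {k}. (z j + 0 * w j) ^ (a ! j)) =
      (if 1 \<le> a ! k then of_nat (a ! k) * w k * monomial (a[k := a ! k - 1]) z else 0)"
      by auto
  qed
  finally show ?thesis .
qed

text \<open>Column \<open>c\<close> is read as the polynomial that the derivation assigns to the
  monomial \<open>a\<close>. A pair \<open>(i,k)\<close> with \<open>1 \<le> a ! k\<close> reaches
  exactly one row, as the basis list is complete and distinct, and the sum over \<open>i\<close>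
  assembles the image of \<open>e_k\<close>.\<close>

lemma row_symrep:
  assumes c: "c < length (sym_monos n d)"
  defines "a \<equiv> sym_monos n d ! c"
  shows "(\<Sum>r<length (sym_monos n d). monomial (sym_monos n d ! r) z * symrep n d g $$ (r,c)) =
    (\<Sum>k<n. if 1 \<le> a ! k then of_nat (a ! k) * subst_lin n g z k * monomial (a[k := a ! k - 1]) z else 0)"
proof -
  let ?B = "sym_monos n d"
  let ?m = "length ?B"
  define u where "u i k = (a[k := a ! k - 1])[i := (a[k := a ! k - 1]) ! i + 1]" for i k
  have a: "length a = n" "sum_list a = d"
    using nth_mem[OF c] by (auto simp: a_def set_sym_monos)
  have S: "symrep n d g $$ (r,c) =
      (\<Sum>i<n. \<Sum>k<n. if 1 \<le> a ! k \<and> ?B ! r = u i k then of_nat (a ! k) * g $$ (i,k) else 0)" if "r < ?m" for r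
    unfolding a_def u_def using that c by (simp add: symrep_def Let_def)
  have delta: "(\<Sum>r<?m. monomial (?B ! r) z * (if 1 \<le> a ! k \<and> ?B ! r = u i k then of_nat (a ! k) * g $$ (i,k) else 0)) =
      (if 1 \<le> a ! k then of_nat (a ! k) * (g $$ (i,k) * z i) * monomial (a[k := a ! k - 1]) z else 0)"
    if ik: "i < n" "k < n" for i k
  proof (cases "1 \<le> a ! k")
    case True
    then have "1 \<le> sum_list a" using elem_le_sum_list[of k a] ik a by simp
    moreover have "a ! k \<le> sum_list a" using elem_le_sum_list[of k a] ik a by simp
    ultimately have "u i k \<in> set ?B"
      using True ik a by (simp add: u_def set_sym_monos sum_list_update)
    then obtain s where s: "s < ?m" "?B ! s = u i k" by (auto simp: in_set_conv_nth)
    have "monomial (u i k) z = z i * monomial (a[k := a ! k - 1]) z"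
      unfolding u_def Suc_eq_plus1[symmetric] by (rule monomial_incr) (use ik a in simp)
    moreover have "(?B ! r = u i k) = (r = s)" if "r < ?m" for r
      using nth_eq_iff_index_eq[OF distinct_sym_monos that s(1)] s(2) by simp
    then have "(\<Sum>r<?m. monomial (?B ! r) z * (if 1 \<le> a ! k \<and> ?B ! r = u i k then of_nat (a ! k) * g $$ (i,k) else 0)) =
        (\<Sum>r<?m. if r = s then monomial (?B ! r) z * (of_nat (a ! k) * g $$ (i,k)) else 0)"
      using True by (intro sum.cong) auto
    ultimately show ?thesis using True s by simp
  qed auto
  have "(\<Sum>r<?m. monomial (?B ! r) z * symrep n d g $$ (r,c)) =
      (\<Sum>r<?m. \<Sum>i<n. \<Sum>k<n. monomial (?B ! r) z *
        (if 1 \<le> a ! k \<and> ?B ! r = u i k then of_nat (a ! k) * g $$ (i,k) else 0))"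
    by (rule sum.cong[OF refl]) (simp add: S sum_distrib_left)
  also have "\<dots> = (\<Sum>i<n. \<Sum>r<?m. \<Sum>k<n. monomial (?B ! r) z *
        (if 1 \<le> a ! k \<and> ?B ! r = u i k then of_nat (a ! k) * g $$ (i,k) else 0))"
    by (rule sum.swap)
  also have "\<dots> = (\<Sum>i<n. \<Sum>k<n. \<Sum>r<?m. monomial (?B ! r) z *
        (if 1 \<le> a ! k \<and> ?B ! r = u i k then of_nat (a ! k) * g $$ (i,k) else 0))"
    by (rule sum.cong[OF refl]) (rule sum.swap)
  also have "\<dots> = (\<Sum>i<n. \<Sum>k<n.
      (if 1 \<le> a ! k then of_nat (a ! k) * (g $$ (i,k) * z i) * monomial (a[k := a ! k - 1]) z else 0))"
    by (rule sum.cong[OF refl], rule sum.cong[OF refl], rule delta) auto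
  also have "\<dots> = (\<Sum>k<n. \<Sum>i<n.
      (if 1 \<le> a ! k then of_nat (a ! k) * (g $$ (i,k) * z i) * monomial (a[k := a ! k - 1]) z else 0))"
    by (rule sum.swap)
  also have "\<dots> = (\<Sum>k<n. if 1 \<le> a ! k then of_nat (a ! k) * subst_lin n g z k * monomial (a[k := a ! k - 1]) z else 0)"
    by (rule sum.cong[OF refl]) (auto simp: subst_lin_def sum_distrib_left sum_distrib_right)
  finally show ?thesis .
qed

text \<open>\<open>symrep n d g\<close> is the derivative at \<open>t = 0\<close> of the substitution \<open>z \<mapsto> z + t g\<^sup>T z\<close>.\<close>

lemma DERIV_symrep:
  assumes "c < length (sym_monos n d)"
  shows "((\<lambda>t. monomial (sym_monos n d ! c) (\<lambda>j. z j + t * subst_lin n g z j)) has_field_derivative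
    (\<Sum>r<length (sym_monos n d). monomial (sym_monos n d ! r) z * symrep n d g $$ (r,c))) (at 0)"
  unfolding row_symrep[OF assms]
  using DERIV_monomial[of "sym_monos n d ! c" z "subst_lin n g z"]
  by (simp add: length_sym_monos_nth[OF assms])

section \<open>Linear substitutions acting on homogeneous polynomials\<close>

text \<open>Only the existence of coefficients is recorded, so the entries of a symmetric power of a
  matrix never have to be computed.\<close>

definition homogeneous :: "nat \<Rightarrow> nat \<Rightarrow> ((nat \<Rightarrow> complex) \<Rightarrow> complex) set" where
  "homogeneous n d = {f. \<exists>v. \<forall>z. f z = (\<Sum>r<length (sym_monos n d). monomial (sym_monos n d ! r) z * v r)}"

lemma homogeneous_add:
  assumes "f \<in> homogeneous n d" "g \<in> homogeneous n d"
  shows "(\<lambda>z. f z + g z) \<in> homogeneous n d"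
proof -
  obtain v w where "\<And>z. f z = (\<Sum>r<length (sym_monos n d). monomial (sym_monos n d ! r) z * v r)"
    "\<And>z. g z = (\<Sum>r<length (sym_monos n d). monomial (sym_monos n d ! r) z * w r)"
    using assms unfolding homogeneous_def by blast
  then show ?thesis unfolding homogeneous_def
    by (intro CollectI exI[of _ "\<lambda>r. v r + w r"]) (simp add: sum.distrib algebra_simps)
qed

lemma homogeneous_cmult:
  assumes "f \<in> homogeneous n d"
  shows "(\<lambda>z. c * f z) \<in> homogeneous n d"
proof -
  obtain v where "\<And>z. f z = (\<Sum>r<length (sym_monos n d). monomial (sym_monos n d ! r) z * v r)"
    using assms unfolding homogeneous_def by blast
  then show ?thesis unfolding homogeneous_def
    by (intro CollectI exI[of _ "\<lambda>r. c * v r"]) (simp add: sum_distrib_left algebra_simps)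
qed

lemma homogeneous_sum:
  "finite J \<Longrightarrow> (\<And>j. j \<in> J \<Longrightarrow> f j \<in> homogeneous n d) \<Longrightarrow> (\<lambda>z. \<Sum>j\<in>J. f j z) \<in> homogeneous n d"
proof (induction J rule: finite_induct)
  case empty
  show ?case unfolding homogeneous_def by (intro CollectI exI[of _ "\<lambda>_. 0"]) simp
qed (simp add: homogeneous_add)

lemma homogeneous_monomial:
  assumes "a \<in> set (sym_monos n d)"
  shows "monomial a \<in> homogeneous n d"
proof -
  obtain s where s: "s < length (sym_monos n d)" "a = sym_monos n d ! s"
    using assms by (auto simp: in_set_conv_nth)
  show ?thesis unfolding homogeneous_def
    by (intro CollectI exI[of _ "\<lambda>r. if r = s then 1 else 0"]) (use s in \<open>simp add: if_distrib cong: if_cong\<close>)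
qed

lemma homogeneous_mult_var:
  assumes "f \<in> homogeneous n d" "i < n"
  shows "(\<lambda>z. z i * f z) \<in> homogeneous n (Suc d)"
proof -
  let ?B = "sym_monos n d"
  obtain v where v: "\<And>z. f z = (\<Sum>r<length ?B. monomial (?B ! r) z * v r)"
    using assms unfolding homogeneous_def by blast
  have "(\<lambda>z. z i * f z) = (\<lambda>z. \<Sum>r<length ?B. v r * monomial ((?B ! r)[i := Suc (?B ! r ! i)]) z)"
    by (intro ext) (auto simp: v sum_distrib_left monomial_incr length_sym_monos_nth assms(2) intro!: sum.cong)
  moreover have "(?B ! r)[i := Suc (?B ! r ! i)] \<in> set (sym_monos n (Suc d))" if "r < length ?B" for r
    using nth_mem[OF that] assms(2) elem_le_sum_list[of i "?B ! r"]
    by (auto simp: set_sym_monos sum_list_update)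
  ultimately show ?thesis
    by (auto intro!: homogeneous_sum homogeneous_cmult homogeneous_monomial)
qed

lemma homogeneous_mult_subst_lin:
  assumes "f \<in> homogeneous n d"
  shows "(\<lambda>z. subst_lin n P z j * f z) \<in> homogeneous n (Suc d)"
proof -
  have "(\<lambda>z. subst_lin n P z j * f z) = (\<lambda>z. \<Sum>i<n. P $$ (i,j) * (z i * f z))"
    by (simp add: subst_lin_def sum_distrib_right mult.assoc)
  then show ?thesis
    using homogeneous_mult_var[OF assms] by (auto intro!: homogeneous_sum homogeneous_cmult)
qed

text \<open>The substituted monomial is a product of \<open>sum_list a\<close> linear forms, and
  each linear form raises the degree by one.\<close>

lemma homogeneous_monomial_subst_lin:
  assumes "length a = n"
  shows "(\<lambda>z. monomial a (subst_lin n P z)) \<in> homogeneous n (sum_list a)"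
proof -
  have pow: "(\<lambda>z. subst_lin n P z j ^ p * f z) \<in> homogeneous n (p + d)" if "f \<in> homogeneous n d" for f j p d
  proof (induction p)
    case (Suc p)
    show ?case using homogeneous_mult_subst_lin[OF Suc] by (simp add: mult.assoc)
  qed (use that in simp)
  have "(\<lambda>z. \<Prod>j<k. subst_lin n P z j ^ (a ! j)) \<in> homogeneous n (\<Sum>j<k. a ! j)" for k
  proof (induction k)
    case 0
    have "replicate n 0 \<in> set (sym_monos n 0)" by (simp add: sym_monos_degree_0)
    from homogeneous_monomial[OF this] show ?case by (simp add: monomial_def[abs_def])
  next
    case (Suc k)
    show ?case using pow[OF Suc, of k "a ! k"] by (simp add: mult.commute add.commute)
  qed
  then show ?thesis
    using assms by (simp add: monomial_def sum_list_sum_nth atLeast0LessThan)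
qed

text \<open>\<open>S\<close> is the multiplicative \<open>d\<close>-th symmetric power of
  \<open>P\<close>, in contrast to the derivation action \<open>symrep\<close>.\<close>

lemma sym_power_matrix_exists:
  obtains S where "S \<in> carrier_mat (length (sym_monos n d)) (length (sym_monos n d))"
    "\<And>z c. c < length (sym_monos n d) \<Longrightarrow> monomial (sym_monos n d ! c) (subst_lin n P z) =
      (\<Sum>r<length (sym_monos n d). monomial (sym_monos n d ! r) z * S $$ (r,c))"
proof -
  let ?B = "sym_monos n d"
  have "\<exists>v. \<forall>z. monomial (?B ! c) (subst_lin n P z) = (\<Sum>r<length ?B. monomial (?B ! r) z * v r)"
    if "c < length ?B" for c
    using homogeneous_monomial_subst_lin[of "?B ! c" n P] nth_mem[OF that]
    by (auto simp: set_sym_monos homogeneous_def)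
  then obtain v where v: "\<And>c z. c < length ?B \<Longrightarrow>
      monomial (?B ! c) (subst_lin n P z) = (\<Sum>r<length ?B. monomial (?B ! r) z * v c r)"
    by metis
  show thesis
    by (rule that[of "mat (length ?B) (length ?B) (\<lambda>(r,c). v c r)"]) (auto simp: v)
qed

text \<open>Columns are compared as polynomial functions; independence of the monomials then allows
  reading off the entries.\<close>

lemma mat_eq_by_monomials:
  assumes "A \<in> carrier_mat (length (sym_monos n d)) k" "B \<in> carrier_mat (length (sym_monos n d)) k"
    and eq: "\<And>z c. c < k \<Longrightarrow> (\<Sum>r<length (sym_monos n d). monomial (sym_monos n d ! r) z * A $$ (r,c)) =
      (\<Sum>r<length (sym_monos n d). monomial (sym_monos n d ! r) z * B $$ (r,c))"
  shows "A = B"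
proof (rule eq_matI)
  fix s c assume sc: "s < dim_row B" "c < dim_col B"
  have "A $$ (s,c) - B $$ (s,c) = 0"
  proof (rule monomials_independent[where v = "\<lambda>r. A $$ (r,c) - B $$ (r,c)"])
    fix z
    show "(\<Sum>r<length (sym_monos n d). (A $$ (r,c) - B $$ (r,c)) * monomial (sym_monos n d ! r) z) = 0"
      using eq[of c z] sc assms by (simp add: algebra_simps sum_subtractf)
  qed (use sc assms in auto)
  then show "A $$ (s,c) = B $$ (s,c)" by simp
qed (use assms in auto)

lemma row_mult_mat:
  assumes "A \<in> carrier_mat m m" "B \<in> carrier_mat m m" "c < m"
  shows "(\<Sum>r<m. (u r :: complex) * (A * B) $$ (r,c)) = (\<Sum>s<m. (\<Sum>r<m. u r * A $$ (r,s)) * B $$ (s,c))"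
proof -
  have "(\<Sum>r<m. u r * (A * B) $$ (r,c)) = (\<Sum>r<m. \<Sum>s<m. u r * A $$ (r,s) * B $$ (s,c))"
    using assms by (intro sum.cong) (auto simp: scalar_prod_def sum_distrib_left atLeast0LessThan mult.assoc)
  also have "\<dots> = (\<Sum>s<m. \<Sum>r<m. u r * A $$ (r,s) * B $$ (s,c))" by (rule sum.swap)
  finally show ?thesis by (simp add: sum_distrib_right)
qed

text \<open>\<open>subst_lin\<close> applies the transpose, and transposition reverses
  products.\<close>

lemma subst_lin_mult:
  assumes "A \<in> carrier_mat n n" "B \<in> carrier_mat n n" "j < n"
  shows "subst_lin n (A * B) z j = subst_lin n B (subst_lin n A z) j"
  unfolding subst_lin_def
  using row_mult_mat[OF assms, of z] by (simp add: mult.commute)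

lemma subst_lin_one: "j < n \<Longrightarrow> subst_lin n (1\<^sub>m n) z j = z j"
  by (simp add: subst_lin_def if_distrib[of "\<lambda>x. x * _"] cong: if_cong)

lemma symrep_carrier: "symrep n d g \<in> carrier_mat (length (sym_monos n d)) (length (sym_monos n d))"
  by (simp add: symrep_def Let_def)

text \<open>The symmetric power \<open>S\<close> of \<open>P\<close> conjugates the derivations.
  Since \<open>X * P = P * T\<close>, the substitution \<open>P\<close> sends the line through
  \<open>z\<close> with the direction given by \<open>X\<close> to the line through the image of
  \<open>z\<close> with the direction given by \<open>T\<close>; differentiating at 0 gives the
  intertwining relation for \<open>S\<close>.\<close>

lemma symrep_similar:
  assumes X: "X \<in> carrier_mat n n" and sim: "similar_mat_wit X T P Q"
  shows "similar_mat (symrep n d X) (symrep n d T)"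
proof -
  let ?B = "sym_monos n d"
  let ?m = "length ?B"
  note wit = similar_mat_witD2[OF X sim]
  obtain S where S: "S \<in> carrier_mat ?m ?m"
    "\<And>z c. c < ?m \<Longrightarrow> monomial (?B ! c) (subst_lin n P z) = (\<Sum>r<?m. monomial (?B ! r) z * S $$ (r,c))"
    using sym_power_matrix_exists[of n d P] by blast
  obtain R where R: "R \<in> carrier_mat ?m ?m"
    "\<And>z c. c < ?m \<Longrightarrow> monomial (?B ! c) (subst_lin n Q z) = (\<Sum>r<?m. monomial (?B ! r) z * R $$ (r,c))"
    using sym_power_matrix_exists[of n d Q] by blast
  \<comment> \<open>Symmetric powers are multiplicative; this is used for both products of
    \<open>P\<close> and \<open>Q\<close>.\<close>
  have inv: "A1 * A2 = 1\<^sub>m ?m" if P12: "P1 * P2 = 1\<^sub>m n" "P1 \<in> carrier_mat n n" "P2 \<in> carrier_mat n n"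
    and A1: "A1 \<in> carrier_mat ?m ?m"
      "\<And>z c. c < ?m \<Longrightarrow> monomial (?B ! c) (subst_lin n P1 z) = (\<Sum>r<?m. monomial (?B ! r) z * A1 $$ (r,c))"
    and A2: "A2 \<in> carrier_mat ?m ?m"
      "\<And>z c. c < ?m \<Longrightarrow> monomial (?B ! c) (subst_lin n P2 z) = (\<Sum>r<?m. monomial (?B ! r) z * A2 $$ (r,c))"
    for P1 P2 A1 A2
  proof (rule mat_eq_by_monomials[of _ n d ?m])
    fix z c assume c: "c < ?m"
    have "(\<Sum>r<?m. monomial (?B ! r) z * (A1 * A2) $$ (r,c)) = (\<Sum>s<?m. monomial (?B ! s) (subst_lin n P1 z) * A2 $$ (s,c))"
      unfolding row_mult_mat[OF A1(1) A2(1) c] by (simp add: A1(2))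
    also have "\<dots> = monomial (?B ! c) (subst_lin n P2 (subst_lin n P1 z))"
      by (simp add: A2(2) c)
    also have "\<dots> = monomial (?B ! c) z"
      by (rule monomial_cong)
        (simp add: length_sym_monos_nth[OF c] subst_lin_mult[OF P12(2,3), symmetric] P12(1) subst_lin_one)
    also have "\<dots> = (\<Sum>r<?m. monomial (?B ! r) z * 1\<^sub>m ?m $$ (r,c))"
      using c by (simp add: if_distrib cong: if_cong)
    finally show "(\<Sum>r<?m. monomial (?B ! r) z * (A1 * A2) $$ (r,c)) = \<dots>" .
  qed (use A1 A2 in auto)
  have XP: "X * P = P * T"
    using wit(1-7) by (metis assoc_mult_mat mult_carrier_mat right_mult_one_mat)
  have comm: "symrep n d X * S = S * symrep n d T"
  proof (rule mat_eq_by_monomials[of _ n d ?m])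
    fix z c assume c: "c < ?m"
    \<comment> \<open>One function of \<open>t\<close> is differentiated in two ways: expanded by
      \<open>S\<close> first, and directly as a moved monomial. Uniqueness of the derivative equates
      the results.\<close>
    have "((\<lambda>t. \<Sum>s<?m. monomial (?B ! s) (\<lambda>j. z j + t * subst_lin n X z j) * S $$ (s,c)) has_field_derivative
        (\<Sum>s<?m. (\<Sum>r<?m. monomial (?B ! r) z * symrep n d X $$ (r,s)) * S $$ (s,c))) (at 0)"
      by (intro DERIV_sum DERIV_cmult_right DERIV_symrep) auto
    moreover have "(\<Sum>s<?m. monomial (?B ! s) (\<lambda>j. z j + t * subst_lin n X z j) * S $$ (s,c)) =
        monomial (?B ! c) (\<lambda>j. subst_lin n P z j + t * subst_lin n T (subst_lin n P z) j)" for t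
    proof -
      have "subst_lin n P (\<lambda>j. z j + t * subst_lin n X z j) j =
          subst_lin n P z j + t * subst_lin n T (subst_lin n P z) j" if "j < n" for j
      proof -
        have "subst_lin n P (\<lambda>j. z j + t * subst_lin n X z j) j =
            subst_lin n P z j + t * subst_lin n P (subst_lin n X z) j"
          by (simp add: subst_lin_def sum.distrib sum_distrib_left algebra_simps)
        also have "subst_lin n P (subst_lin n X z) j = subst_lin n T (subst_lin n P z) j"
          using subst_lin_mult[OF X wit(6) that] subst_lin_mult[OF wit(6,5) that] XP by metis
        finally show ?thesis .
      qed
      then have "monomial (?B ! c) (subst_lin n P (\<lambda>j. z j + t * subst_lin n X z j)) =
          monomial (?B ! c) (\<lambda>j. subst_lin n P z j + t * subst_lin n T (subst_lin n P z) j)"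
        by (intro monomial_cong) (simp add: length_sym_monos_nth[OF c])
      then show ?thesis by (simp add: S(2)[OF c])
    qed
    ultimately have "((\<lambda>t. monomial (?B ! c) (\<lambda>j. subst_lin n P z j + t * subst_lin n T (subst_lin n P z) j))
        has_field_derivative (\<Sum>s<?m. (\<Sum>r<?m. monomial (?B ! r) z * symrep n d X $$ (r,s)) * S $$ (s,c))) (at 0)"
      by simp
    from DERIV_unique[OF this DERIV_symrep[OF c]]
    show "(\<Sum>r<?m. monomial (?B ! r) z * (symrep n d X * S) $$ (r,c)) =
        (\<Sum>r<?m. monomial (?B ! r) z * (S * symrep n d T) $$ (r,c))"
      unfolding row_mult_mat[OF symrep_carrier S(1) c] row_mult_mat[OF S(1) symrep_carrier c]
      by (simp add: S(2))
  qed (rule mult_carrier_mat[OF symrep_carrier S(1)] mult_carrier_mat[OF S(1) symrep_carrier])+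
  have SR: "S * R = 1\<^sub>m ?m" by (rule inv[OF wit(1,6,7) S R])
  have RS: "R * S = 1\<^sub>m ?m" by (rule inv[OF wit(2,7,6) R S])
  have "symrep n d X = S * symrep n d T * R"
    using comm SR S(1) R(1) symrep_carrier[of n d X] symrep_carrier[of n d T]
    by (metis assoc_mult_mat right_mult_one_mat)
  then show ?thesis
    unfolding similar_mat_def similar_mat_wit_def
    using SR RS S(1) R(1) symrep_carrier[of n d X] symrep_carrier[of n d T]
    by (intro exI[of _ S] exI[of _ R]) (auto simp: Let_def)
qed

subsection \<open>The coefficient algebra\<close>

lemma genmat_carrier [simp]: "genmat n y \<in> carrier_mat n n"
  by (simp add: genmat_def)

text \<open>Entries of \<open>symrep n d g\<close> are linear in \<open>g\<close>, so the
  combination of basis matrices may be formed before or after passing to the symmetric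
  power.\<close>

lemma genrep_eq_symrep: "genrep n d y = symrep n d (genmat n y)"
proof (rule eq_matI)
  let ?B = "sym_monos n d"
  fix r c assume "r < dim_row (symrep n d (genmat n y))" "c < dim_col (symrep n d (genmat n y))"
  then have rc: "r < length ?B" "c < length ?B" by (simp_all add: symrep_def Let_def)
  define u where "u i k = (1 \<le> ?B ! c ! k \<and> ?B ! r = ((?B ! c)[k := ?B ! c ! k - 1])[i := ((?B ! c)[k := ?B ! c ! k - 1]) ! i + 1])" for i k
  have S: "symrep n d g $$ (r,c) = (\<Sum>i<n. \<Sum>k<n. if u i k then of_nat (?B ! c ! k) * g $$ (i,k) else 0)" for g
    unfolding u_def using rc by (simp add: symrep_def Let_def)
  have "genrep n d y $$ (r,c) = (\<Sum>l\<in>sl_index n. \<Sum>i<n. \<Sum>k<n. if u i k then of_nat (?B ! c ! k) * (y l * sl_basis n l $$ (i,k)) else 0)"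
    using rc by (simp add: genrep_def Let_def S sum_distrib_left if_distrib mult.left_commute cong: if_cong)
  also have "\<dots> = (\<Sum>i<n. \<Sum>l\<in>sl_index n. \<Sum>k<n. if u i k then of_nat (?B ! c ! k) * (y l * sl_basis n l $$ (i,k)) else 0)"
    by (rule sum.swap)
  also have "\<dots> = (\<Sum>i<n. \<Sum>k<n. \<Sum>l\<in>sl_index n. if u i k then of_nat (?B ! c ! k) * (y l * sl_basis n l $$ (i,k)) else 0)"
    by (rule sum.cong[OF refl]) (rule sum.swap)
  also have "\<dots> = (\<Sum>i<n. \<Sum>k<n. if u i k then of_nat (?B ! c ! k) * genmat n y $$ (i,k) else 0)"
    by (intro sum.cong refl) (auto simp: genmat_def sum_distrib_left)
  finally show "genrep n d y $$ (r,c) = symrep n d (genmat n y) $$ (r,c)" unfolding S .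
qed (simp_all add: genrep_def symrep_def Let_def)

text \<open>The sign reconciles \<open>det (x I + A)\<close> with the convention
  \<open>det (x I - A)\<close> of \<open>char_poly\<close>.\<close>

lemma charpoly_gen_eq: "charpoly_gen n d y = char_poly ((-1) \<cdot>\<^sub>m symrep n d (genmat n y))"
  unfolding charpoly_gen_def char_poly_def Let_def genrep_eq_symrep
  by (rule arg_cong[where f = det], rule eq_matI)
    (use symrep_carrier[of n d "genmat n y"] in \<open>auto simp: char_poly_matrix_def\<close>)

section \<open>Triangular form on the symmetric power\<close>

lemma char_poly_uminus_lower_triangular:
  assumes A: "(A :: complex mat) \<in> carrier_mat m m"
    and lower: "\<And>r c. r < c \<Longrightarrow> c < m \<Longrightarrow> A $$ (r,c) = 0"
  shows "char_poly ((-1) \<cdot>\<^sub>m A) = (\<Prod>r<m. [:A $$ (r,r), 1:])"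
proof -
  let ?M = "char_poly_matrix ((-1) \<cdot>\<^sub>m A)"
  have M: "?M \<in> carrier_mat m m" using A by simp
  have "char_poly ((-1) \<cdot>\<^sub>m A) = prod_list (diag_mat ?M)"
    unfolding char_poly_def by (rule det_lower_triangular[OF _ M]) (use A lower in \<open>auto simp: char_poly_matrix_def\<close>)
  also have "\<dots> = (\<Prod>r<m. ?M $$ (r,r))"
    using M by (simp add: diag_mat_def prod.list_conv_set_nth atLeast0LessThan)
  also have "\<dots> = (\<Prod>r<m. [:A $$ (r,r), 1:])"
    using A by (intro prod.cong refl) (simp add: char_poly_matrix_def)
  finally show ?thesis .
qed

lemma radix_update:
  "k < length a \<Longrightarrow> radix N (a[k := v]) + a ! k * N ^ (length a - Suc k) = radix N a + v * N ^ (length a - Suc k)"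
proof (induction a arbitrary: k)
  case (Cons x a)
  then show ?case by (cases k) (auto simp: algebra_simps)
qed simp

text \<open>Moving a unit from digit \<open>k\<close> to the more significant digit \<open>i\<close>
  gains more than it loses.\<close>

lemma radix_shift_less:
  assumes "i < k" "k < length a" "1 \<le> a ! k" "2 \<le> N"
  shows "radix N a < radix N ((a[k := a ! k - 1])[i := (a[k := a ! k - 1]) ! i + 1])"
proof -
  let ?a = "a[k := a ! k - 1]"
  let ?p = "\<lambda>i. N ^ (length a - Suc i)"
  obtain v where v: "a ! k = Suc v" using assms(3) by (cases "a ! k") auto
  have "radix N ?a + ?p k = radix N a"
    using radix_update[of k a N v] assms v by simp
  moreover have "radix N (?a[i := ?a ! i + 1]) = radix N ?a + ?p i"
    using radix_update[of i ?a N "?a ! i + 1"] assms by simp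
  moreover have "?p k < ?p i" by (rule power_strict_increasing) (use assms in auto)
  ultimately show ?thesis by linarith
qed

text \<open>A nonzero \<open>T $$ (i,k)\<close> has \<open>i \<le> k\<close>. Replacing
  \<open>e_k\<close> by such an \<open>e_i\<close> keeps the monomial or moves it up
  lexicographically, so no row before \<open>c\<close> is reached.\<close>

lemma symrep_lower_triangular:
  assumes T: "T \<in> carrier_mat n n" "upper_triangular T" and rc: "r < c" "c < length (sym_monos n d)"
  shows "symrep n d T $$ (r,c) = 0"
proof -
  let ?B = "sym_monos n d"
  let ?a = "?B ! c"
  let ?u = "\<lambda>i k. (?a[k := ?a ! k - 1])[i := (?a[k := ?a ! k - 1]) ! i + 1]"
  have a: "length ?a = n" "sum_list ?a = d" using nth_mem[OF rc(2)] by (auto simp: set_sym_monos)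
  have less: "radix (d + 1) (?B ! r) < radix (d + 1) ?a" by (rule radix_sym_monos_less[OF rc])
  have "(if 1 \<le> ?a ! k \<and> ?B ! r = ?u i k then of_nat (?a ! k) * T $$ (i,k) else 0) = 0"
    if ik: "i < n" "k < n" for i k
  proof (cases "1 \<le> ?a ! k \<and> ?B ! r = ?u i k")
    case True
    have "?a ! k \<le> d" using elem_le_sum_list[of k ?a] ik a by simp
    then have d: "2 \<le> d + 1" using True by linarith
    have "i \<noteq> k" using True less ik a by auto
    moreover have "\<not> i < k" using radix_shift_less[of i k ?a "d + 1"] True less ik a d by auto
    ultimately have "T $$ (i,k) = 0" using T ik by auto
    then show ?thesis by simp
  next
    case False
    then show ?thesis by (rule if_not_P)
  qed
  then show ?thesis using rc unfolding symrep_def Let_def by simp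
qed

text \<open>Replacing \<open>e_k\<close> by \<open>e_i\<close> returns the same monomial only for
  \<open>i = k\<close>, and then with coefficient \<open>a ! k\<close>.\<close>

lemma symrep_diagonal:
  assumes c: "c < length (sym_monos n d)"
  shows "symrep n d T $$ (c,c) = weight n (\<lambda>k. T $$ (k,k)) (sym_monos n d ! c)"
proof -
  let ?a = "sym_monos n d ! c"
  let ?u = "\<lambda>i k. (?a[k := ?a ! k - 1])[i := (?a[k := ?a ! k - 1]) ! i + 1]"
  have a: "length ?a = n" by (rule length_sym_monos_nth[OF c])
  have "(if 1 \<le> ?a ! k \<and> ?a = ?u i k then of_nat (?a ! k) * T $$ (i,k) else 0) =
      (if i = k then of_nat (?a ! k) * T $$ (i,k) else 0)"
    if ik: "i < n" "k < n" for i k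
  proof (cases "i = k")
    case True
    have "?u k k = ?a" if "0 < ?a ! k" using that ik a by simp
    then show ?thesis using True by (cases "?a ! k = 0") auto
  next
    case False
    then have "?u i k ! k = ?a ! k - 1" using ik a by simp
    then have "1 \<le> ?a ! k \<longrightarrow> ?a \<noteq> ?u i k" by (metis diff_less less_irrefl less_one order_less_le_trans zero_less_one)
    then show ?thesis using False by auto
  qed
  then have "symrep n d T $$ (c,c) = (\<Sum>i<n. \<Sum>k<n. if i = k then of_nat (?a ! k) * T $$ (i,k) else 0)"
    using c unfolding symrep_def Let_def by simp
  then show ?thesis by (simp add: weight_def)
qed

section \<open>Traces and eigenvalues\<close>

lemma mtrace_mult_commute:
  assumes "A \<in> carrier_mat n n" "B \<in> carrier_mat n n"
  shows "mtrace (A * B) = mtrace (B * A)"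
proof -
  have "mtrace (A * B) = (\<Sum>i<n. \<Sum>j<n. A $$ (i,j) * B $$ (j,i))"
    using assms by (auto simp: mtrace_def scalar_prod_def atLeast0LessThan intro!: sum.cong)
  also have "\<dots> = (\<Sum>j<n. \<Sum>i<n. A $$ (i,j) * B $$ (j,i))" by (rule sum.swap)
  also have "\<dots> = mtrace (B * A)"
    using assms by (auto simp: mtrace_def scalar_prod_def atLeast0LessThan mult.commute intro!: sum.cong)
  finally show ?thesis .
qed

lemma mtrace_conjugate:
  assumes "P \<in> carrier_mat n n" "Q \<in> carrier_mat n n" "T \<in> carrier_mat n n" "Q * P = 1\<^sub>m n"
  shows "mtrace (P * T * Q) = mtrace T"
proof -
  have "mtrace (P * T * Q) = mtrace (Q * (P * T))"
    by (rule mtrace_mult_commute) (use assms in auto)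
  also have "Q * (P * T) = T"
    using assms by (metis assoc_mult_mat left_mult_one_mat)
  finally show ?thesis .
qed

lemma upper_triangular_pow:
  assumes T: "(T :: complex mat) \<in> carrier_mat n n" "upper_triangular T"
  shows "upper_triangular (T ^\<^sub>m k) \<and> (\<forall>j<n. (T ^\<^sub>m k) $$ (j,j) = T $$ (j,j) ^ k)"
proof (induction k)
  case (Suc k)
  have C: "T ^\<^sub>m k \<in> carrier_mat n n" using T by simp
  have e: "(T ^\<^sub>m Suc k) $$ (i,j) = (\<Sum>l<n. (T ^\<^sub>m k) $$ (i,l) * T $$ (l,j))" if "i < n" "j < n" for i j
    using that T C by (simp add: scalar_prod_def atLeast0LessThan)
  have z: "(T ^\<^sub>m k) $$ (i,l) * T $$ (l,j) = 0" if "i < n" "j < n" "l < n" "l < i \<or> j < l" for i j l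
    using that Suc T C by (auto simp: upper_triangular_def)
  show ?case
  proof (intro conjI allI impI)
    show "upper_triangular (T ^\<^sub>m Suc k)"
    proof
      fix i j assume "j < i" "i < dim_row (T ^\<^sub>m Suc k)"
      then have ij: "i < n" "j < n" "j < i" using T C by auto
      show "(T ^\<^sub>m Suc k) $$ (i,j) = 0"
        unfolding e[OF ij(1,2)] by (intro sum.neutral ballI z) (use ij in auto)
    qed
    fix j assume j: "j < n"
    have "(T ^\<^sub>m Suc k) $$ (j,j) = (\<Sum>l<n. if l = j then (T ^\<^sub>m k) $$ (j,j) * T $$ (j,j) else 0)"
      unfolding e[OF j j] by (rule sum.cong) (use z j in \<open>auto simp: nat_neq_iff\<close>)
    then show "(T ^\<^sub>m Suc k) $$ (j,j) = T $$ (j,j) ^ Suc k" using j Suc by simp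
  qed
qed (use T in auto)

text \<open>\<open>x\<close> is the diagonal of a Schur form of \<open>X\<close>. The three facts
  stand in one statement because the same \<open>x\<close> must serve all of them and every
  \<open>d\<close>.\<close>

lemma eigenvalues_exist:
  "\<exists>x. (\<forall>d. charpoly_gen n d y = (\<Prod>r<length (sym_monos n d). [:weight n x (sym_monos n d ! r), 1:])) \<and>
    (\<forall>i. tr_fun n i y = power_sum {..<n} x i) \<and>
    char_poly (genmat n y) = (\<Prod>j<n. [:- x j, 1:])"
proof -
  let ?X = "genmat n y"
  have X: "?X \<in> carrier_mat n n" by simp
  obtain es where es: "char_poly ?X = (\<Prod>a\<leftarrow>es. [:- a, 1:])"
    using char_poly_factorized[OF X] by blast
  obtain T where T: "T \<in> carrier_mat n n" "upper_triangular T" "similar_mat ?X T"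
    using schur_decomposition_exists[OF X es] by blast
  obtain P Q where PQ: "similar_mat_wit ?X T P Q" using T(3) unfolding similar_mat_def by blast
  note wit = similar_mat_witD2[OF X PQ]
  let ?x = "\<lambda>j. T $$ (j,j)"
  have "charpoly_gen n d y = (\<Prod>r<length (sym_monos n d). [:weight n ?x (sym_monos n d ! r), 1:])" for d
  proof -
    obtain P' Q' where "similar_mat_wit (symrep n d ?X) (symrep n d T) P' Q'"
      using symrep_similar[OF X PQ] unfolding similar_mat_def by blast
    from similar_mat_wit_smult[OF this, of "-1"]
    have "similar_mat ((-1) \<cdot>\<^sub>m symrep n d ?X) ((-1) \<cdot>\<^sub>m symrep n d T)"
      unfolding similar_mat_def by blast
    then have "charpoly_gen n d y = char_poly ((-1) \<cdot>\<^sub>m symrep n d T)"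
      unfolding charpoly_gen_eq by (rule char_poly_similar)
    also have "\<dots> = (\<Prod>r<length (sym_monos n d). [:symrep n d T $$ (r,r), 1:])"
      by (rule char_poly_uminus_lower_triangular[OF symrep_carrier]) (rule symrep_lower_triangular[OF T(1,2)])
    finally show ?thesis by (simp add: symrep_diagonal)
  qed
  moreover have "tr_fun n i y = power_sum {..<n} ?x i" for i
  proof -
    have "tr_fun n i y = mtrace (P * T ^\<^sub>m i * Q)"
      unfolding tr_fun_def similar_mat_wit_pow_id[OF PQ] ..
    also have "\<dots> = mtrace (T ^\<^sub>m i)"
      by (rule mtrace_conjugate[OF wit(6,7) _ wit(2)]) (use T in simp)
    also have "\<dots> = power_sum {..<n} ?x i"
      using upper_triangular_pow[OF T(1,2), of i] T(1) by (simp add: mtrace_def power_sum_def)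
    finally show ?thesis .
  qed
  moreover have "char_poly ?X = (\<Prod>j<n. [:- ?x j, 1:])"
  proof -
    have "char_poly ?X = (\<Prod>a\<leftarrow>diag_mat T. [:- a, 1:])"
      unfolding char_poly_similar[OF T(3)] by (rule char_poly_upper_triangular[OF T(1,2)])
    then show ?thesis
      using T(1) by (simp add: diag_mat_def prod.list_conv_set_nth atLeast0LessThan)
  qed
  ultimately show ?thesis by (intro exI[of _ ?x]) simp
qed

text \<open>An arbitrary choice for each \<open>y\<close>; it enters only symmetric expressions, so
  the order of the eigenvalues is immaterial.\<close>

definition eigenvalues :: "nat \<Rightarrow> (nat \<times> nat \<Rightarrow> complex) \<Rightarrow> nat \<Rightarrow> complex" where
  "eigenvalues n y = (SOME x.
    (\<forall>d. charpoly_gen n d y = (\<Prod>r<length (sym_monos n d). [:weight n x (sym_monos n d ! r), 1:])) \<and>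
    (\<forall>i. tr_fun n i y = power_sum {..<n} x i) \<and>
    char_poly (genmat n y) = (\<Prod>j<n. [:- x j, 1:]))"

lemma
  shows charpoly_gen_eigenvalues: "charpoly_gen n d y =
      (\<Prod>r<length (sym_monos n d). [:weight n (eigenvalues n y) (sym_monos n d ! r), 1:])"
    and tr_fun_eigenvalues: "tr_fun n i y = power_sum {..<n} (eigenvalues n y) i"
    and char_poly_eigenvalues: "char_poly (genmat n y) = (\<Prod>j<n. [:- eigenvalues n y j, 1:])"
  using someI_ex[OF eigenvalues_exist[of n y]] unfolding eigenvalues_def[symmetric] by auto

text \<open>Reversing the coefficients turns \<open>x + w r\<close> into the factor
  \<open>1 + w r * x\<close> of the generating function.\<close>

lemma coeff_prod_esym:
  assumes "k \<le> m"
  shows "coeff (\<Prod>r<m. [:w r, 1:]) (m - k) = esym {..<m} w k"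
proof -
  let ?p = "\<Prod>r<m. [:w r, 1:]"
  have deg: "degree ?p = m"
    by (subst degree_prod_eq_sum_degree) auto
  have "reflect_poly [:w r, 1:] = [:1, w r:]" for r
    by (cases "w r = 0") (auto simp: reflect_poly_def)
  then have "esym {..<m} w k = coeff (reflect_poly ?p) k"
    by (simp add: esym_def reflect_poly_prod)
  then show ?thesis using assms by (simp add: coeff_reflect_poly deg)
qed

lemma mtrace_genmat: "mtrace (genmat n y) = 0"
proof -
  have "mtrace (genmat n y) = (\<Sum>l\<in>sl_index n. y l * (\<Sum>a<n. sl_basis n l $$ (a,a)))"
    unfolding mtrace_def genmat_def by (simp add: sum_distrib_left sum.swap[of _ "{..<n}"])
  also have "\<dots> = 0"
  proof (rule sum.neutral, rule ballI)
    fix l assume l: "l \<in> sl_index n"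
    obtain i j where ij: "l = (i,j)" by (cases l)
    have "(\<Sum>a<n. sl_basis n l $$ (a,a)) = 0"
    proof (cases "i = j")
      case True
      then have "i < n" "Suc i < n" using l ij by (auto simp: sl_index_def)
      then show ?thesis
        by (simp add: sl_basis_def ij True Eunit_def sum_subtractf)
    qed (auto simp: sl_basis_def ij Eunit_def)
    then show "y l * (\<Sum>a<n. sl_basis n l $$ (a,a)) = 0" by simp
  qed
  finally show ?thesis .
qed

lemma tr_fun_1: "tr_fun n 1 y = 0"
proof -
  have "genmat n y ^\<^sub>m 1 = genmat n y" by (simp add: genmat_def)
  then show ?thesis by (simp add: tr_fun_def mtrace_genmat)
qed

text \<open>Newton's identities remove the exponents above \<open>n\<close>, and tracelessness
  removes the exponent 1.\<close>

lemma alg_gen_tr_fun: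
  "alg_gen {tr_fun n i | i. 1 \<le> i} = alg_gen {tr_fun n i | i. 2 \<le> i \<and> i \<le> n}"
proof
  let ?R = "alg_gen {tr_fun n i | i. 2 \<le> i \<and> i \<le> n}"
  have tr: "tr_fun n i = (\<lambda>y. power_sum {..<n} (eigenvalues n y) i)" for i
    by (rule ext) (rule tr_fun_eigenvalues)
  have small: "tr_fun n i \<in> ?R" if "1 \<le> i" "i \<le> n" for i
  proof (cases "i = 1")
    case True
    then have "tr_fun n i = (\<lambda>_. 0)" using tr_fun_1 by (intro ext) auto
    then show ?thesis by (simp add: alg_gen.const)
  next
    case False
    then show ?thesis using that by (intro alg_gen.gen) auto
  qed
  show "alg_gen {tr_fun n i | i. 1 \<le> i} \<subseteq> ?R"
  proof (rule alg_gen_subset, clarify)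
    fix i
    have "tr_fun n i \<in> alg_gen {tr_fun n i | i. 1 \<le> i \<and> i \<le> n}"
      using power_sum_in_alg_power_sum[of "{..<n}" "eigenvalues n" i] by (simp add: tr)
    also have "\<dots> \<subseteq> ?R" by (rule alg_gen_subset) (use small in auto)
    finally show "tr_fun n i \<in> ?R" .
  qed
qed (auto intro!: alg_gen_mono)

text \<open>Generators are exchanged in turn: coefficients, power sums of the weights, power sums of
  the eigenvalues, traces.\<close>

lemma coeff_alg_eq:
  assumes "1 \<le> n" "1 \<le> d"
  shows "coeff_alg n d = alg_gen {tr_fun n i | i. 2 \<le> i \<and> i \<le> n}"
proof -
  let ?B = "sym_monos n d"
  let ?m = "length ?B"
  define w where "w y r = weight n (eigenvalues n y) (?B ! r)" for y r
  have E: "(\<lambda>y. coeff (charpoly_gen n d y) (?m - k)) = (\<lambda>y. esym {..<?m} (w y) k)" if "k \<le> ?m" for k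
    using coeff_prod_esym[OF that] by (simp add: charpoly_gen_eigenvalues w_def[abs_def])
  \<comment> \<open>Distinctness of the basis list lets a sum over row indices become a sum over the
    set of exponent vectors.\<close>
  have P: "power_sum {..<?m} (w y) i = weight_sum n d (eigenvalues n y) i" for y i
  proof -
    have "power_sum {..<?m} (w y) i = sum_list (map (\<lambda>a. weight n (eigenvalues n y) a ^ i) ?B)"
      by (simp add: power_sum_def w_def sum.list_conv_set_nth sum_list_sum_nth atLeast0LessThan)
    then show ?thesis
      by (simp add: weight_sum_def sum_list_distinct_conv_sum_set distinct_sym_monos)
  qed
  have "coeff_alg n d = alg_gen {\<lambda>y. esym {..<?m} (w y) k | k. 1 \<le> k \<and> k \<le> ?m}"
    unfolding coeff_alg_def Let_def by (rule arg_cong[where f = alg_gen]) (use E in \<open>auto, metis\<close>)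
  also have "\<dots> = alg_gen {\<lambda>y. power_sum {..<?m} (w y) i | i. 1 \<le> i}"
  proof
    show "alg_gen {\<lambda>y. esym {..<?m} (w y) k | k. 1 \<le> k \<and> k \<le> ?m} \<subseteq> alg_gen {\<lambda>y. power_sum {..<?m} (w y) i | i. 1 \<le> i}"
    proof (rule alg_gen_subset, clarify)
      fix k
      have "(\<lambda>y. esym {..<?m} (w y) k) \<in> alg_gen {\<lambda>y. power_sum {..<?m} (w y) i | i. 1 \<le> i \<and> i \<le> k}"
        by (rule esym_in_alg_power_sum) simp
      also have "\<dots> \<subseteq> alg_gen {\<lambda>y. power_sum {..<?m} (w y) i | i. 1 \<le> i}"
        by (rule alg_gen_mono) auto
      finally show "(\<lambda>y. esym {..<?m} (w y) k) \<in> alg_gen {\<lambda>y. power_sum {..<?m} (w y) i | i. 1 \<le> i}" .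
    qed
    show "alg_gen {\<lambda>y. power_sum {..<?m} (w y) i | i. 1 \<le> i} \<subseteq> alg_gen {\<lambda>y. esym {..<?m} (w y) k | k. 1 \<le> k \<and> k \<le> ?m}"
      using power_sum_in_alg_esym[of "{..<?m}" w] by (intro alg_gen_subset) auto
  qed
  also have "\<dots> = alg_gen {\<lambda>y. power_sum {..<n} (eigenvalues n y) i | i. 1 \<le> i}"
    unfolding P by (rule alg_gen_weight_sums[OF assms(2,1)])
  also have "\<dots> = alg_gen {tr_fun n i | i. 1 \<le> i}"
    by (simp add: tr_fun_eigenvalues[abs_def])
  finally show ?thesis unfolding alg_gen_tr_fun .
qed

subsection \<open>Conjugation invariants\<close>

text \<open>At most two basis elements meet a diagonal position; the guards handle the two ends of
  the diagonal, where one of them is missing.\<close>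

lemma genmat_index:
  assumes "a < n" "b < n"
  shows "genmat n y $$ (a,b) = (if a \<noteq> b then y (a,b) else
    (if a + 1 < n then y (a,a) else 0) - (if 1 \<le> a then y (a - 1,a - 1) else 0))"
proof -
  have fin: "finite (sl_index n)"
    by (rule finite_subset[of _ "{..<n} \<times> {..<n}"]) (auto simp: sl_index_def)
  have G: "genmat n y $$ (a,b) = (\<Sum>l\<in>sl_index n. y l * sl_basis n l $$ (a,b))"
    using assms by (simp add: genmat_def)
  show ?thesis
  proof (cases "a = b")
    case False
    have "genmat n y $$ (a,b) = (\<Sum>l\<in>sl_index n. if l = (a,b) then y l else 0)"
      unfolding G by (rule sum.cong)
        (use False assms in \<open>auto simp: sl_index_def sl_basis_def Eunit_def split: prod.splits if_splits\<close>)
    then show ?thesis using False assms fin by (simp add: sl_index_def)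
  next
    case True
    have "genmat n y $$ (a,b) = (\<Sum>l\<in>sl_index n. (if l = (a,a) then y l else 0) -
        (if l = (a - 1,a - 1) then (if 1 \<le> a then y l else 0) else 0))"
      unfolding G by (rule sum.cong)
        (use True assms in \<open>auto simp: sl_index_def sl_basis_def Eunit_def split: prod.splits if_splits\<close>)
    then show ?thesis using True assms fin by (auto simp: sl_index_def sum_subtractf)
  qed
qed

text \<open>On the diagonal, \<open>coords\<close> takes partial sums and \<open>genmat\<close>
  takes their differences; the last position works because the full sum is the trace.\<close>

lemma genmat_coords:
  assumes A: "A \<in> carrier_mat n n" and tr: "mtrace A = 0"
  shows "genmat n (coords n A) = A"
proof (rule eq_matI)
  fix a b assume "a < dim_row A" "b < dim_col A"
  then have ab: "a < n" "b < n" using A by auto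
  show "genmat n (coords n A) $$ (a,b) = A $$ (a,b)"
  proof (cases "a = b")
    case False
    then show ?thesis using ab by (simp add: genmat_index coords_def sl_index_def)
  next
    case True
    define S where "S i = (\<Sum>t\<le>i. A $$ (t,t))" for i
    have c: "coords n A (i,i) = S i" if "i + 1 < n" for i
      using that by (simp add: coords_def sl_index_def S_def)
    have Sn: "S (n - 1) = 0"
    proof -
      have "{..n - 1} = {..<n}" using ab by auto
      then show ?thesis using tr A by (simp add: S_def mtrace_def)
    qed
    have eq: "S a - (if 1 \<le> a then S (a - 1) else 0) = A $$ (a,a)"
      by (cases a) (simp_all add: S_def)
    have "genmat n (coords n A) $$ (a,b) = S a - (if 1 \<le> a then S (a - 1) else 0)"
    proof (cases "a + 1 < n")
      case True
      then show ?thesis using ab \<open>a = b\<close> by (simp add: genmat_index c)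
    next
      case False
      then have "S a = 0" using Sn ab by (metis Suc_eq_plus1 Suc_lessI diff_Suc_1)
      then show ?thesis using ab \<open>a = b\<close> False by (auto simp: genmat_index c)
    qed
    then show ?thesis using eq True by simp
  qed
qed (use A in \<open>simp_all add: genmat_def\<close>)

lemma genmat_entry_polyfun:
  assumes "i < n" "j < n"
  shows "(\<lambda>y. genmat n y $$ (i,j)) \<in> polyfun n"
proof -
  have "(\<lambda>y. genmat n y $$ (i,j)) = (\<lambda>y. \<Sum>l\<in>sl_index n. sl_basis n l $$ (i,j) * y l)"
    using assms by (simp add: genmat_def mult.commute)
  moreover have "(\<lambda>y. y l) \<in> alg_gen {\<lambda>y. y l | l. l \<in> sl_index n}" if "l \<in> sl_index n" for l
    by (rule alg_gen.gen) (use that in blast)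
  ultimately show ?thesis unfolding polyfun_def
    by (auto intro!: alg_gen_sum alg_gen_cmult)
qed

lemma genmat_pow_entry_polyfun:
  "i < n \<Longrightarrow> j < n \<Longrightarrow> (\<lambda>y. (genmat n y ^\<^sub>m k) $$ (i,j)) \<in> polyfun n"
proof (induction k arbitrary: i j)
  case 0
  then show ?case by (simp add: polyfun_def genmat_def alg_gen.const)
next
  case (Suc k)
  have "(genmat n y ^\<^sub>m Suc k) $$ (i,j) = (\<Sum>l<n. (genmat n y ^\<^sub>m k) $$ (i,l) * genmat n y $$ (l,j))" for y
    using Suc.prems by (simp add: scalar_prod_def atLeast0LessThan genmat_def)
  then show ?case
    using Suc genmat_entry_polyfun unfolding polyfun_def
    by (auto intro!: alg_gen_sum alg_gen.mult)
qed

lemma tr_fun_polyfun: "tr_fun n i \<in> polyfun n"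
proof -
  have "tr_fun n i = (\<lambda>y. \<Sum>j<n. (genmat n y ^\<^sub>m i) $$ (j,j))"
    by (rule ext) (simp add: tr_fun_def mtrace_def genmat_def)
  then show ?thesis using genmat_pow_entry_polyfun[of _ n _ i]
    unfolding polyfun_def by (auto intro!: alg_gen_sum)
qed

lemma tr_fun_conjugate:
  assumes g: "g \<in> carrier_mat n n" "h \<in> carrier_mat n n" "g * h = 1\<^sub>m n" "h * g = 1\<^sub>m n"
  shows "tr_fun n i (coords n (g * genmat n y * h)) = tr_fun n i y"
proof -
  let ?X = "genmat n y"
  let ?A = "g * ?X * h"
  have A: "?A \<in> carrier_mat n n" using g by auto
  have "mtrace ?A = 0" using mtrace_conjugate[OF g(1,2) genmat_carrier g(4)] by (simp add: mtrace_genmat)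
  then have "genmat n (coords n ?A) = ?A" by (rule genmat_coords[OF A])
  moreover have "similar_mat_wit ?A ?X g h"
    using g A by (simp add: similar_mat_wit_def Let_def genmat_def)
  ultimately have "tr_fun n i (coords n ?A) = mtrace (g * ?X ^\<^sub>m i * h)"
    by (simp add: tr_fun_def similar_mat_wit_pow_id[of ?A])
  also have "\<dots> = tr_fun n i y"
    unfolding tr_fun_def by (rule mtrace_conjugate[OF g(1,2) _ g(4)]) simp
  finally show ?thesis .
qed

lemma alg_gen_tr_fun_subset_inv_ring: "alg_gen {tr_fun n i | i. 2 \<le> i \<and> i \<le> n} \<subseteq> inv_ring n"
proof
  fix f assume "f \<in> alg_gen {tr_fun n i | i. 2 \<le> i \<and> i \<le> n}"
  then show "f \<in> inv_ring n"
  proof induction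
    case (const c)
    then show ?case by (simp add: inv_ring_def polyfun_def alg_gen.const)
  next
    case (gen f)
    then show ?case using tr_fun_polyfun tr_fun_conjugate by (auto simp: inv_ring_def)
  next
    case (add f g)
    then show ?case by (simp add: inv_ring_def polyfun_def alg_gen.add)
  next
    case (mult f g)
    then show ?case by (simp add: inv_ring_def polyfun_def alg_gen.mult)
  qed
qed

section \<open>The Cayley-Hamilton theorem and companion matrices\<close>

lemma pow_mat_Suc_left:
  assumes "A \<in> carrier_mat n n"
  shows "A ^\<^sub>m Suc k = A * A ^\<^sub>m k"
proof (induction k)
  case (Suc k)
  have "A ^\<^sub>m Suc (Suc k) = A * A ^\<^sub>m k * A" using Suc by simp
  also have "\<dots> = A * (A ^\<^sub>m k * A)" using assms by (intro assoc_mult_mat) auto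
  finally show ?case by simp
qed (use assms in simp)

text \<open>Compare coefficients in \<open>(x I - X) * adj = char_poly X * I\<close>, multiply the
  \<open>k\<close>-th identity by \<open>X ^ k\<close> and telescope.\<close>

lemma cayley_hamilton:
  fixes X :: "complex mat"
  assumes X: "X \<in> carrier_mat n n" and ij: "i < n" "j < n"
  shows "(\<Sum>k\<le>n. coeff (char_poly X) k * (X ^\<^sub>m k) $$ (i,j)) = 0"
proof -
  let ?M = "char_poly_matrix X"
  have M: "?M \<in> carrier_mat n n" using X by simp
  note adj = adj_mat[OF M]
  \<comment> \<open>Column \<open>j\<close> of the coefficient of \<open>x ^ (k - 1)\<close> in the
    adjugate; the shift by one, with value 0 at \<open>k = 0\<close>, accounts for the
    multiplication by \<open>x\<close>.\<close>
  define b where "b k p = (if k = 0 then 0 else coeff (adj_mat ?M $$ (p,j)) (k - 1))" for k p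
  have eq: "b k p - (\<Sum>l<n. X $$ (p,l) * b (Suc k) l) = (if p = j then coeff (char_poly X) k else 0)"
    if p: "p < n" for k p
  proof -
    have "(?M * adj_mat ?M) $$ (p,j) = (\<Sum>l<n. ?M $$ (p,l) * adj_mat ?M $$ (l,j))"
      using M adj(1) p ij by (simp add: scalar_prod_def atLeast0LessThan)
    also have "\<dots> = (\<Sum>l<n. (if l = p then [:0,1:] * adj_mat ?M $$ (l,j) else 0) - smult (X $$ (p,l)) (adj_mat ?M $$ (l,j)))"
      using X p by (intro sum.cong) (auto simp: char_poly_matrix_def algebra_simps)
    also have "\<dots> = [:0,1:] * adj_mat ?M $$ (p,j) - (\<Sum>l<n. smult (X $$ (p,l)) (adj_mat ?M $$ (l,j)))"
      using p by (simp add: sum_subtractf)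
    finally have "[:0,1:] * adj_mat ?M $$ (p,j) - (\<Sum>l<n. smult (X $$ (p,l)) (adj_mat ?M $$ (l,j))) =
        (if p = j then char_poly X else 0)"
      using adj(2) p ij by (cases "p = j") (simp_all add: char_poly_def)
    from arg_cong[OF this, of "\<lambda>q. coeff q k"] show ?thesis
      by (cases k) (auto simp: b_def coeff_sum coeff_pCons split: if_splits)
  qed
  define G where "G k = (\<Sum>p<n. (X ^\<^sub>m k) $$ (i,p) * b k p)" for k
  have step: "coeff (char_poly X) k * (X ^\<^sub>m k) $$ (i,j) = G k - G (Suc k)" for k
  proof -
    have "G (Suc k) = (\<Sum>l<n. (\<Sum>p<n. (X ^\<^sub>m k) $$ (i,p) * X $$ (p,l)) * b (Suc k) l)"
      unfolding G_def using X ij by (intro sum.cong refl) (simp add: scalar_prod_def atLeast0LessThan)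
    also have "\<dots> = (\<Sum>l<n. \<Sum>p<n. (X ^\<^sub>m k) $$ (i,p) * (X $$ (p,l) * b (Suc k) l))"
      by (simp add: sum_distrib_right mult.assoc)
    also have "\<dots> = (\<Sum>p<n. \<Sum>l<n. (X ^\<^sub>m k) $$ (i,p) * (X $$ (p,l) * b (Suc k) l))"
      by (rule sum.swap)
    finally have "G k - G (Suc k) = (\<Sum>p<n. (X ^\<^sub>m k) $$ (i,p) * (b k p - (\<Sum>l<n. X $$ (p,l) * b (Suc k) l)))"
      by (simp add: G_def sum_distrib_left sum_subtractf right_diff_distrib)
    also have "\<dots> = (\<Sum>p<n. (X ^\<^sub>m k) $$ (i,p) * (if p = j then coeff (char_poly X) k else 0))"
      by (rule sum.cong[OF refl]) (simp add: eq)
    finally show ?thesis using ij by (simp add: if_distrib mult.commute cong: if_cong)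
  qed
  \<comment> \<open>\<open>D\<close> lies above \<open>n\<close> and beyond every coefficient of the
    adjugate column, so the upper end of the telescoping sum vanishes.\<close>
  define D where "D = Suc n + (\<Sum>p<n. Suc (degree (adj_mat ?M $$ (p,j))))"
  have "b D p = 0" if "p < n" for p
  proof -
    have "Suc (degree (adj_mat ?M $$ (p,j))) \<le> (\<Sum>p<n. Suc (degree (adj_mat ?M $$ (p,j))))"
      using that by (intro member_le_sum) auto
    then show ?thesis unfolding b_def D_def by (auto intro: coeff_eq_0)
  qed
  then have GD: "G D = 0" by (simp add: G_def)
  have G0: "G 0 = 0" by (simp add: G_def b_def)
  have "degree (char_poly X) = n" using degree_monic_char_poly[OF X] by simp
  then have "(\<Sum>k\<le>n. coeff (char_poly X) k * (X ^\<^sub>m k) $$ (i,j)) = (\<Sum>k<D. coeff (char_poly X) k * (X ^\<^sub>m k) $$ (i,j))"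
    by (intro sum.mono_neutral_left) (auto simp: D_def coeff_eq_0)
  also have "\<dots> = G 0 - G D" unfolding step by (rule sum_lessThan_telescope')
  finally show ?thesis using GD G0 by simp
qed

text \<open>Oriented with the coefficients in the last column, to fit Krylov vectors as columns of
  the conjugating matrix.\<close>

definition companion :: "nat \<Rightarrow> complex mat \<Rightarrow> complex mat" where
  "companion n X = mat n n (\<lambda>(i,j). if j + 1 < n then (if i = j + 1 then 1 else 0) else - coeff (char_poly X) i)"

text \<open>The Krylov matrix of the first unit vector; it conjugates \<open>X\<close> into companion form
  wherever it is invertible.\<close>

definition krylov :: "nat \<Rightarrow> complex mat \<Rightarrow> complex mat" where
  "krylov n X = mat n n (\<lambda>(i,j). (X ^\<^sub>m j) $$ (i,0))"

text \<open>Multiplication by \<open>X\<close> shifts the Krylov columns; for the last one,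
  Cayley-Hamilton expresses the power \<open>n\<close> by lower powers.\<close>

lemma krylov_companion:
  assumes X: "X \<in> carrier_mat n n"
  shows "X * krylov n X = krylov n X * companion n X"
proof (rule eq_matI)
  fix i j assume "i < dim_row (krylov n X * companion n X)" "j < dim_col (krylov n X * companion n X)"
  then have ij: "i < n" "j < n" by (auto simp: krylov_def companion_def)
  have comm: "X ^\<^sub>m Suc j = X * X ^\<^sub>m j"
    using X by (rule pow_mat_Suc_left)
  have "(X * krylov n X) $$ (i,j) = (\<Sum>l<n. X $$ (i,l) * (X ^\<^sub>m j) $$ (l,0))"
    using X ij by (simp add: krylov_def scalar_prod_def atLeast0LessThan)
  also have "\<dots> = (X ^\<^sub>m Suc j) $$ (i,0)"
    unfolding comm using X ij by (simp add: scalar_prod_def atLeast0LessThan)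
  also have "\<dots> = (\<Sum>l<n. (X ^\<^sub>m l) $$ (i,0) * companion n X $$ (l,j))"
  proof (cases "j + 1 < n")
    case True
    then have "(\<Sum>l<n. (X ^\<^sub>m l) $$ (i,0) * companion n X $$ (l,j)) =
        (\<Sum>l<n. if l = Suc j then (X ^\<^sub>m l) $$ (i,0) else 0)"
      using ij by (intro sum.cong) (auto simp: companion_def)
    then show ?thesis using True by simp
  next
    case False
    then have n: "n = Suc j" using ij by simp
    have "coeff (char_poly X) n = 1" using degree_monic_char_poly[OF X] by simp
    then have "(X ^\<^sub>m n) $$ (i,0) + (\<Sum>l<n. coeff (char_poly X) l * (X ^\<^sub>m l) $$ (i,0)) = 0"
      using cayley_hamilton[OF X ij(1), of 0] ij by (simp add: lessThan_Suc_atMost[symmetric] add.commute)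
    then have "(X ^\<^sub>m n) $$ (i,0) = (\<Sum>l<n. - (coeff (char_poly X) l * (X ^\<^sub>m l) $$ (i,0)))"
      by (simp add: sum_negf eq_neg_iff_add_eq_0)
    also have "\<dots> = (\<Sum>l<n. (X ^\<^sub>m l) $$ (i,0) * companion n X $$ (l,j))"
      using False ij by (intro sum.cong) (auto simp: companion_def)
    finally show ?thesis unfolding n .
  qed
  also have "\<dots> = (krylov n X * companion n X) $$ (i,j)"
    using ij by (simp add: krylov_def companion_def scalar_prod_def atLeast0LessThan)
  finally show "(X * krylov n X) $$ (i,j) = \<dots>" .
qed (use X in \<open>auto simp: krylov_def companion_def\<close>)

text \<open>Dividing the Krylov matrix by an \<open>n\<close>-th root of its determinant brings it
  into the special linear group without changing the conjugation.\<close>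

lemma conjugate_companion:
  assumes X: "X \<in> carrier_mat n n" and n: "1 \<le> n" and det: "det (krylov n X) \<noteq> 0"
  obtains g h where "g \<in> carrier_mat n n" "h \<in> carrier_mat n n" "g * h = 1\<^sub>m n" "h * g = 1\<^sub>m n"
    "det g = 1" "g * companion n X * h = X"
proof -
  let ?K = "krylov n X"
  let ?C = "companion n X"
  have K: "?K \<in> carrier_mat n n" and C: "?C \<in> carrier_mat n n"
    by (auto simp: krylov_def companion_def)
  have ss: "a \<cdot>\<^sub>m (b \<cdot>\<^sub>m A) = (a * b) \<cdot>\<^sub>m A" "1 \<cdot>\<^sub>m A = A" for a b :: complex and A
    by (auto intro: eq_matI)
  define Ki where "Ki = (1 / det ?K) \<cdot>\<^sub>m adj_mat ?K"
  have Ki: "Ki \<in> carrier_mat n n" "?K * Ki = 1\<^sub>m n" "Ki * ?K = 1\<^sub>m n"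
    using adj_mat[OF K] det K by (auto simp: Ki_def mult_smult_distrib[of _ n n] mult_smult_assoc_mat[of _ n n] ss)
  obtain r where r: "r ^ n = det ?K" using nth_root_exists[of n "det ?K"] n by auto
  then have r0: "r \<noteq> 0" using det n by (cases n) auto
  show thesis
  proof (rule that[of "(1 / r) \<cdot>\<^sub>m ?K" "r \<cdot>\<^sub>m Ki"])
    show "(1 / r) \<cdot>\<^sub>m ?K \<in> carrier_mat n n" "r \<cdot>\<^sub>m Ki \<in> carrier_mat n n" using K Ki by auto
    show "(1 / r) \<cdot>\<^sub>m ?K * (r \<cdot>\<^sub>m Ki) = 1\<^sub>m n" "r \<cdot>\<^sub>m Ki * ((1 / r) \<cdot>\<^sub>m ?K) = 1\<^sub>m n"
      using K Ki r0 by (auto simp: mult_smult_distrib[of _ n n] mult_smult_assoc_mat[of _ n n] ss)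
    show "det ((1 / r) \<cdot>\<^sub>m ?K) = 1"
      using K r r0 det by (simp add: det_smult power_divide)
    have "(1 / r) \<cdot>\<^sub>m ?K * ?C * (r \<cdot>\<^sub>m Ki) = ?K * ?C * Ki"
      using K C Ki r0 by (auto simp: mult_smult_distrib[of _ n n] mult_smult_assoc_mat[of _ n n] ss)
    also have "\<dots> = X * ?K * Ki" unfolding krylov_companion[OF X] ..
    also have "\<dots> = X" using X K Ki by (simp add: assoc_mult_mat[of _ n n])
    finally show "(1 / r) \<cdot>\<^sub>m ?K * ?C * (r \<cdot>\<^sub>m Ki) = X" .
  qed
qed

text \<open>The coefficients are elementary symmetric in the negated eigenvalues, whose power sums
  are the traces up to sign.\<close>

lemma coeff_char_poly_in_alg_tr_fun:
  assumes "k < n"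
  shows "(\<lambda>y. coeff (char_poly (genmat n y)) k) \<in> alg_gen {tr_fun n i | i. 2 \<le> i \<and> i \<le> n}"
proof -
  have "coeff (char_poly (genmat n y)) k = esym {..<n} (\<lambda>j. - eigenvalues n y j) (n - k)" for y
    unfolding char_poly_eigenvalues
    using coeff_prod_esym[of "n - k" n "\<lambda>j. - eigenvalues n y j"] assms by simp
  moreover have "(\<lambda>y. esym {..<n} (\<lambda>j. - eigenvalues n y j) (n - k)) \<in>
      alg_gen {\<lambda>y. power_sum {..<n} (\<lambda>j. - eigenvalues n y j) i | i. 1 \<le> i \<and> i \<le> n - k}"
    by (rule esym_in_alg_power_sum) simp
  moreover have "alg_gen {\<lambda>y. power_sum {..<n} (\<lambda>j. - eigenvalues n y j) i | i. 1 \<le> i \<and> i \<le> n - k} \<subseteq>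
      alg_gen {tr_fun n i | i. 2 \<le> i \<and> i \<le> n}"
  proof (rule alg_gen_subset, clarify)
    fix i :: nat assume "1 \<le> i"
    have "(\<lambda>y. power_sum {..<n} (\<lambda>j. - eigenvalues n y j) i) = (\<lambda>y. (-1) ^ i * tr_fun n i y)"
      by (rule ext) (simp add: tr_fun_eigenvalues power_sum_def sum_distrib_left flip: power_mult_distrib)
    moreover have "tr_fun n i \<in> alg_gen {tr_fun n i | i. 2 \<le> i \<and> i \<le> n}"
      unfolding alg_gen_tr_fun[symmetric] by (rule alg_gen.gen) (use \<open>1 \<le> i\<close> in auto)
    ultimately show "(\<lambda>y. power_sum {..<n} (\<lambda>j. - eigenvalues n y j) i) \<in> alg_gen {tr_fun n i | i. 2 \<le> i \<and> i \<le> n}"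
      by (simp add: alg_gen_cmult)
  qed
  ultimately show ?thesis by auto
qed

section \<open>Polynomial functions that vanish generically\<close>

lemma polyfun_line:
  assumes "p \<in> polyfun n"
  shows "\<exists>P. \<forall>t. p (\<lambda>l. y l + t * (w l - y l)) = poly P t"
  using assms unfolding polyfun_def
proof induction
  case (const c)
  show ?case by (intro exI[of _ "[:c:]"]) simp
next
  case (gen f)
  then obtain l where "f = (\<lambda>y. y l)" by auto
  then show ?case by (intro exI[of _ "[:y l, w l - y l:]"]) simp
next
  case (add f g)
  then show ?case by (metis poly_add)
next
  case (mult f g)
  then show ?case by (metis poly_mult)
qed

text \<open>Restrict to the line from \<open>y\<close> to \<open>w\<close>. There
  \<open>P * Q\<close> vanishes identically while \<open>Q\<close> is nonzero at
  \<open>t = 1\<close>, so \<open>P\<close> is the zero polynomial and its value at 0 is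
  \<open>p y\<close>. This stands in for Zariski density.\<close>

lemma polyfun_eq_0_if_generically_0:
  assumes p: "p \<in> polyfun n" and q: "q \<in> polyfun n" "q w \<noteq> 0" and pq: "\<And>y. q y \<noteq> 0 \<Longrightarrow> p y = 0"
  shows "p y = 0"
proof -
  obtain P where P: "\<And>t. p (\<lambda>l. y l + t * (w l - y l)) = poly P t"
    using polyfun_line[OF p] by blast
  obtain Q where Q: "\<And>t. q (\<lambda>l. y l + t * (w l - y l)) = poly Q t"
    using polyfun_line[OF q(1)] by blast
  have "poly (P * Q) t = 0" for t
    using pq[of "\<lambda>l. y l + t * (w l - y l)"] P Q by auto
  then have "P * Q = 0" using poly_all_0_iff_0 by blast
  moreover have "poly Q 1 \<noteq> 0" using Q[of 1, symmetric] q(2) by simp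
  ultimately have "P = 0" by auto
  then show ?thesis using P[of 0] by simp
qed

lemma det_krylov_polyfun: "(\<lambda>y. det (krylov n (genmat n y))) \<in> polyfun n"
proof -
  have "det (krylov n (genmat n y)) = (\<Sum>\<pi> | \<pi> permutes {0..<n}. signof \<pi> * (\<Prod>i = 0..<n. (genmat n y ^\<^sub>m \<pi> i) $$ (i,0)))" for y
    unfolding krylov_def det_def by (auto intro!: sum.cong prod.cong simp: permutes_in_image)
  then show ?thesis
    using genmat_pow_entry_polyfun[of _ n 0]
    unfolding polyfun_def by (auto intro!: alg_gen_sum alg_gen_cmult alg_gen_prod)
qed

text \<open>The shift sends each \<open>e_j\<close> to the next basis vector, so its Krylov vectors
  are the standard basis; it supplies a point where the Krylov determinant is nonzero.\<close>

lemma krylov_shift: "krylov n (mat n n (\<lambda>(i,j). if i = j + 1 then 1 else 0)) = 1\<^sub>m n"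
proof (rule eq_matI)
  let ?N = "mat n n (\<lambda>(i,j). if i = j + 1 then 1 else 0) :: complex mat"
  fix i j assume "i < dim_row (1\<^sub>m n)" "j < dim_col (1\<^sub>m n)"
  then have ij: "i < n" "j < n" by auto
  have "(?N ^\<^sub>m k) $$ (i,0) = (if i = k then 1 else 0)" if "i < n" for i k
    using that
  proof (induction k arbitrary: i)
    case (Suc k)
    have comm: "?N ^\<^sub>m Suc k = ?N * ?N ^\<^sub>m k"
      by (rule pow_mat_Suc_left[of _ n]) simp
    have "(?N ^\<^sub>m Suc k) $$ (i,0) = (\<Sum>l<n. ?N $$ (i,l) * (?N ^\<^sub>m k) $$ (l,0))"
      unfolding comm using Suc.prems by (simp add: scalar_prod_def atLeast0LessThan)
    also have "\<dots> = (\<Sum>l<n. if l = k then (if i = k + 1 then 1 else 0) else 0)"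
      using Suc by (intro sum.cong) auto
    finally show ?case using Suc.prems by auto
  qed auto
  then show "krylov n ?N $$ (i,j) = 1\<^sub>m n $$ (i,j)" using ij by (simp add: krylov_def)
qed (auto simp: krylov_def)

text \<open>Only the last diagonal entry could be nonzero, and it is the trace of
  \<open>genmat n y\<close>. Tracelessness lets \<open>coords\<close> represent the companion matrix
  faithfully.\<close>

lemma mtrace_companion:
  assumes "1 \<le> n"
  shows "mtrace (companion n (genmat n y)) = 0"
proof -
  let ?x = "eigenvalues n y"
  have "coeff (char_poly (genmat n y)) (n - 1) = esym {..<n} (\<lambda>j. - ?x j) 1"
    unfolding char_poly_eigenvalues using coeff_prod_esym[OF assms, of "\<lambda>j. - ?x j"] .
  also have "\<dots> = - power_sum {..<n} ?x 1"
    using newton_identity[of "{..<n}" 0 "\<lambda>j. - ?x j"] by (simp add: power_sum_def sum_negf)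
  also have "\<dots> = 0" using tr_fun_1[of n y] by (simp add: tr_fun_eigenvalues)
  finally have c: "coeff (char_poly (genmat n y)) (n - 1) = 0" .
  have "companion n (genmat n y) $$ (i,i) = 0" if "i < n" for i
  proof (cases "i + 1 < n")
    case False
    then have "i = n - 1" using that by simp
    then show ?thesis using that c by (simp add: companion_def)
  qed (use that in \<open>simp add: companion_def\<close>)
  then show ?thesis by (simp add: mtrace_def companion_def)
qed

text \<open>\<open>F\<close>, the value of \<open>f\<close> on companion matrices, lies in the
  algebra because the companion entries do. It agrees with \<open>f\<close> wherever the Krylov
  determinant is nonzero, hence everywhere.\<close>

lemma inv_ring_subset_alg_gen_tr_fun:
  assumes n: "1 \<le> n"
  shows "inv_ring n \<subseteq> alg_gen {tr_fun n i | i. 2 \<le> i \<and> i \<le> n}" (is "_ \<subseteq> ?R")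
proof
  fix f assume f: "f \<in> inv_ring n"
  then have fp: "f \<in> polyfun n" by (simp add: inv_ring_def)
  define C where "C y = companion n (genmat n y)" for y
  define F where "F y = f (coords n (C y))" for y
  have R: "?R \<subseteq> polyfun n" unfolding polyfun_def
    by (rule alg_gen_subset) (use tr_fun_polyfun in \<open>auto simp: polyfun_def\<close>)
  have C_in: "(\<lambda>y. C y $$ (i,j)) \<in> ?R" if "i < n" "j < n" for i j
    using that alg_gen_uminus[OF coeff_char_poly_in_alg_tr_fun[OF that(1)]]
    by (cases "j + 1 < n") (auto simp: C_def companion_def alg_gen.const)
  have F_in: "F \<in> ?R"
    using fp unfolding polyfun_def F_def[abs_def]
  proof induction
    case (gen f)
    then obtain i j where l: "f = (\<lambda>y. y (i,j))" "(i,j) \<in> sl_index n" by auto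
    show ?case
    proof (cases "i = j")
      case True
      then show ?thesis using l C_in by (auto simp: coords_def sl_index_def intro!: alg_gen_sum)
    next
      case False
      then show ?thesis using l C_in by (auto simp: coords_def sl_index_def)
    qed
  qed (auto intro: alg_gen.intros)
  have inv: "f (coords n (g * genmat n y * h)) = f y"
    if "g \<in> carrier_mat n n" "h \<in> carrier_mat n n" "g * h = 1\<^sub>m n" "h * g = 1\<^sub>m n" "det g = 1" for g h y
    using f that unfolding inv_ring_def by blast
  \<comment> \<open>\<open>y\<close> and \<open>coords n (genmat n y)\<close> may differ outside
    \<open>sl_index n\<close>; invariance under the identity matrix identifies the two values of
    \<open>f\<close>.\<close>
  have f_coords: "f (coords n (genmat n y)) = f y" for y
    using inv[of "1\<^sub>m n" "1\<^sub>m n" y] by (simp add: left_mult_one_mat[OF genmat_carrier] right_mult_one_mat[OF genmat_carrier])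
  have gen: "f y - F y = 0" if det: "det (krylov n (genmat n y)) \<noteq> 0" for y
  proof -
    obtain g h where gh: "g \<in> carrier_mat n n" "h \<in> carrier_mat n n" "g * h = 1\<^sub>m n" "h * g = 1\<^sub>m n"
      "det g = 1" "g * C y * h = genmat n y"
      using conjugate_companion[OF genmat_carrier n det] unfolding C_def by blast
    have "mtrace (C y) = 0"
      unfolding C_def by (rule mtrace_companion[OF n])
    then have "genmat n (coords n (C y)) = C y"
      by (intro genmat_coords) (auto simp: C_def companion_def)
    then have "f (coords n (genmat n y)) = F y"
      using inv[OF gh(1-5), of "coords n (C y)"] gh(6) by (simp add: F_def)
    then show ?thesis using f_coords by simp
  qed
  let ?N = "mat n n (\<lambda>(i,j). if i = j + 1 then 1 else 0) :: complex mat"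
  have "mtrace ?N = 0" by (simp add: mtrace_def)
  then have "genmat n (coords n ?N) = ?N" by (intro genmat_coords) auto
  then have "det (krylov n (genmat n (coords n ?N))) \<noteq> 0" using krylov_shift[of n] by simp
  moreover have "(\<lambda>y. f y - F y) \<in> polyfun n"
    using fp F_in R unfolding polyfun_def by (intro alg_gen_diff) auto
  ultimately have "f y - F y = 0" for y
    using polyfun_eq_0_if_generically_0[OF _ det_krylov_polyfun, of "\<lambda>y. f y - F y" n] gen by blast
  then have "f = F" by auto
  then show "f \<in> ?R" using F_in by simp
qed

subsection \<open>Algebraic independence of the traces\<close>

text \<open>The elementary symmetric functions with prescribed power sums \<open>\<tau>\<close>, by Newton's identities.\<close>

fun newton_esym :: "(nat \<Rightarrow> complex) \<Rightarrow> nat \<Rightarrow> complex" where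
  "newton_esym \<tau> 0 = 1"
| "newton_esym \<tau> (Suc k) = (\<Sum>i\<in>{..k}. (-1)^(k-i) * newton_esym \<tau> i * \<tau> (Suc (k - i))) / of_nat (Suc k)"

text \<open>Newton's recursion fixes the elementary symmetric values, and the fundamental theorem of
  algebra splits the monic polynomial having them as coefficients.\<close>

lemma power_sums_surjective:
  obtains w where "\<And>i. 1 \<le> i \<Longrightarrow> i \<le> n \<Longrightarrow> power_sum {..<n} w i = \<tau> i"
proof -
  define q where "q = (\<Sum>k\<le>n. monom (newton_esym \<tau> k) (n - k))"
  have coeff_q: "coeff q (n - k) = newton_esym \<tau> k" if "k \<le> n" for k
  proof -
    have "coeff q (n - k) = (\<Sum>l\<le>n. if l = k then newton_esym \<tau> l else 0)"
      unfolding q_def coeff_sum coeff_monom using that by (intro sum.cong) auto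
    then show ?thesis using that by simp
  qed
  have lead: "coeff q n = 1" using coeff_q[of 0] by simp
  have "degree q \<le> n" unfolding q_def
    by (intro degree_sum_le) (auto intro: order_trans[OF degree_monom_le])
  then have deg: "degree q = n" using lead by (metis le_antisym le_degree zero_neq_one)
  obtain as where as: "q = (\<Prod>a\<leftarrow>as. [:- a, 1:])"
    using fundamental_theorem_algebra_factorized[of q] lead deg by auto
  have "length as = n" using deg unfolding as by (simp add: degree_linear_factors)
  \<comment> \<open>Negated roots, since \<open>coeff_prod_esym\<close> uses the factors
    \<open>x + w r\<close>.\<close>
  define w where "w r = - as ! r" for r
  have q: "q = (\<Prod>r<n. [:w r, 1:])"
    using \<open>length as = n\<close> by (simp add: as w_def prod.list_conv_set_nth atLeast0LessThan)
  have e: "esym {..<n} w k = newton_esym \<tau> k" if "k \<le> n" for k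
    using coeff_prod_esym[OF that, of w] coeff_q[OF that] unfolding q by simp
  have "power_sum {..<n} w i = \<tau> i" if "1 \<le> i" "i \<le> n" for i
    using that
  proof (induction i rule: less_induct)
    case (less i)
    then obtain k where i: "i = Suc k" by (cases i) auto
    have split: "{..k} = insert 0 {1..k}" by auto
    have "power_sum {..<n} w (Suc k) * (-1)^k = of_nat (Suc k) * newton_esym \<tau> (Suc k) -
        (\<Sum>j\<in>{1..k}. (-1)^(k-j) * newton_esym \<tau> j * \<tau> (Suc (k - j)))"
      unfolding newton_power_sum[OF finite_lessThan] using less i
      by (auto simp: e intro!: sum.cong)
    also have "of_nat (Suc k) * newton_esym \<tau> (Suc k) =
        (\<Sum>j\<in>{..k}. (-1)^(k-j) * newton_esym \<tau> j * \<tau> (Suc (k - j)))"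
      by (simp del: of_nat_Suc)
    finally have "power_sum {..<n} w (Suc k) * (-1)^k = (-1)^k * \<tau> (Suc k)"
      unfolding split by simp
    then show ?case using i by simp
  qed
  then show thesis by (rule that)
qed

text \<open>Take a diagonal matrix whose entries have the wanted power sums; the first one is set to
  0 to make the matrix traceless.\<close>

lemma tr_fun_surjective: "\<exists>y. \<forall>i\<in>{2..n}. tr_fun n i y = \<tau> i"
proof -
  obtain w where w: "\<And>i. 1 \<le> i \<Longrightarrow> i \<le> n \<Longrightarrow> power_sum {..<n} w i = (\<tau>(1 := 0)) i"
    using power_sums_surjective[of n "\<tau>(1 := 0)"] by blast
  define D where "D = mat n n (\<lambda>(i,j). if i = j then w i else 0)"
  have D: "D \<in> carrier_mat n n" "upper_triangular D" by (auto simp: D_def)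
  have tr: "mtrace (D ^\<^sub>m i) = power_sum {..<n} w i" for i
    using upper_triangular_pow[OF D, of i] D(1) by (simp add: mtrace_def power_sum_def D_def)
  have "mtrace D = 0"
  proof (cases "n = 0")
    case False
    then show ?thesis using tr[of 1] w[of 1] D(1) by simp
  qed (use D in \<open>simp add: mtrace_def\<close>)
  then have "genmat n (coords n D) = D" by (rule genmat_coords[OF D(1)])
  then have "tr_fun n i (coords n D) = \<tau> i" if "i \<in> {2..n}" for i
    using tr[of i] w[of i] that by (simp add: tr_fun_def)
  then show ?thesis by blast
qed

text \<open>By surjectivity the traces can be given the values of Kronecker's substitution, under
  which a relation becomes a polynomial in \<open>t\<close> whose coefficients are those of
  \<open>p\<close>.\<close>

lemma alg_indep_tr_fun: "alg_indep {2..n} (tr_fun n)"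
  unfolding alg_indep_def
proof (intro allI impI)
  fix p :: "(nat \<Rightarrow>\<^sub>0 nat) \<Rightarrow>\<^sub>0 complex"
  assume keys: "\<forall>\<alpha>\<in>Poly_Mapping.keys p. Poly_Mapping.keys \<alpha> \<subseteq> {2..n}"
    and zero: "\<forall>y. mpoly_eval p (tr_fun n) y = 0"
  let ?K = "Poly_Mapping.keys p"
  have key: "i \<in> {2..n}" if "\<alpha> \<in> ?K" "i \<in> Poly_Mapping.keys \<alpha>" for \<alpha> i
    using keys that by blast
  \<comment> \<open>Exponents of the variables 0 to \<open>n\<close>; for the monomials of
    \<open>p\<close> those at 0 and 1 are zero.\<close>
  define expo where "expo \<alpha> = map (Poly_Mapping.lookup \<alpha>) [0..<Suc n]" for \<alpha> :: "nat \<Rightarrow>\<^sub>0 nat"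
  have length_expo: "length (expo \<alpha>) = Suc n" for \<alpha> by (simp add: expo_def)
  \<comment> \<open>A base exceeding every exponent that occurs in \<open>p\<close>, so that
    \<open>radix N\<close> separates its monomials.\<close>
  define N where "N = Suc (\<Sum>\<alpha>\<in>?K. sum_list (expo \<alpha>))"
  have bound: "\<forall>x\<in>set (expo \<alpha>). x < N" if "\<alpha> \<in> ?K" for \<alpha>
  proof
    fix x assume "x \<in> set (expo \<alpha>)"
    then have "x \<le> sum_list (expo \<alpha>)" by (simp add: member_le_sum_list)
    also have "\<dots> \<le> (\<Sum>\<alpha>\<in>?K. sum_list (expo \<alpha>))" using that by (intro member_le_sum) auto
    finally show "x < N" by (simp add: N_def)
  qed
  have inj: "\<alpha> = \<beta>" if "\<alpha> \<in> ?K" "\<beta> \<in> ?K" "radix N (expo \<alpha>) = radix N (expo \<beta>)" for \<alpha> \<beta>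
  proof (rule poly_mapping_eqI)
    fix i
    have "expo \<alpha> = expo \<beta>"
      by (rule radix_inj[OF bound[OF that(1)] bound[OF that(2)] _ that(3)]) (simp add: length_expo)
    then show "Poly_Mapping.lookup \<alpha> i = Poly_Mapping.lookup \<beta> i"
    proof (cases "i \<le> n")
      case True
      then have "expo \<gamma> ! i = Poly_Mapping.lookup \<gamma> i" for \<gamma>
        unfolding expo_def by (subst nth_map) (auto simp del: upt_Suc)
      then show ?thesis using \<open>expo \<alpha> = expo \<beta>\<close> by metis
    next
      case False
      then have "i \<notin> Poly_Mapping.keys \<alpha>" "i \<notin> Poly_Mapping.keys \<beta>"
        using key[OF that(1), of i] key[OF that(2), of i] by auto
      then show ?thesis by (simp add: in_keys_iff)
    qed
  qed
  define P where "P = (\<Sum>\<alpha>\<in>?K. monom (Poly_Mapping.lookup p \<alpha>) (radix N (expo \<alpha>)))"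
  have "poly P t = 0" for t
  proof -
    let ?\<tau> = "\<lambda>j. t ^ (N ^ (Suc n - Suc j))"
    obtain y where y: "\<forall>i\<in>{2..n}. tr_fun n i y = ?\<tau> i" using tr_fun_surjective[of n ?\<tau>] by blast
    have "(\<Prod>i\<in>Poly_Mapping.keys \<alpha>. tr_fun n i y ^ Poly_Mapping.lookup \<alpha> i) = t ^ radix N (expo \<alpha>)"
      if "\<alpha> \<in> ?K" for \<alpha>
    proof -
      have "(\<Prod>i\<in>Poly_Mapping.keys \<alpha>. tr_fun n i y ^ Poly_Mapping.lookup \<alpha> i) =
          (\<Prod>i\<in>Poly_Mapping.keys \<alpha>. ?\<tau> i ^ Poly_Mapping.lookup \<alpha> i)"
        using y key[OF that] by (intro prod.cong refl) auto
      also have "\<dots> = (\<Prod>i<Suc n. ?\<tau> i ^ Poly_Mapping.lookup \<alpha> i)"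
      proof (rule prod.mono_neutral_left)
        show "Poly_Mapping.keys \<alpha> \<subseteq> {..<Suc n}"
        proof
          fix i assume "i \<in> Poly_Mapping.keys \<alpha>"
          from key[OF that this] show "i \<in> {..<Suc n}" by simp
        qed
      qed (simp_all add: in_keys_iff)
      also have "\<dots> = (\<Prod>i<Suc n. ?\<tau> i ^ (expo \<alpha> ! i))"
        by (rule prod.cong[OF refl]) (simp add: expo_def del: upt_Suc)
      also have "\<dots> = monomial (expo \<alpha>) ?\<tau>"
        unfolding monomial_def length_expo ..
      also have "\<dots> = t ^ radix N (expo \<alpha>)"
        using monomial_radix[of "expo \<alpha>" t N] unfolding length_expo .
      finally show ?thesis .
    qed
    then have "poly P t = mpoly_eval p (tr_fun n) y"
      unfolding P_def mpoly_eval_def poly_sum poly_monom by (intro sum.cong refl) auto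
    then show ?thesis using zero by simp
  qed
  then have P0: "P = 0" using poly_all_0_iff_0 by blast
  show "p = 0"
  proof (rule poly_mapping_eqI)
    fix \<beta>
    show "Poly_Mapping.lookup p \<beta> = Poly_Mapping.lookup 0 \<beta>"
    proof (cases "\<beta> \<in> ?K")
      case True
      have "coeff P (radix N (expo \<beta>)) = (\<Sum>\<alpha>\<in>?K. if \<alpha> = \<beta> then Poly_Mapping.lookup p \<alpha> else 0)"
        unfolding P_def coeff_sum coeff_monom using inj True by (intro sum.cong) auto
      then show ?thesis using True P0 by simp
    qed (simp add: in_keys_iff)
  qed
qed

theorem theorem1p3:
  fixes n d :: nat
  assumes "n \<ge> 2" and "d \<ge> 1"
  shows "coeff_alg n d = alg_gen {tr_fun n i | i. 2 \<le> i \<and> i \<le> n}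
       \<and> alg_indep {2..n} (tr_fun n)
       \<and> alg_gen {tr_fun n i | i. 2 \<le> i \<and> i \<le> n} = inv_ring n"
proof -
  have "1 \<le> n" using assms by simp
  then show ?thesis
    using coeff_alg_eq[OF _ assms(2)] alg_indep_tr_fun alg_gen_tr_fun_subset_inv_ring
      inv_ring_subset_alg_gen_tr_fun by blast
qed

end
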